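(* Let $k$ be a field and let $X$ be a finite set of $s$ points in the projective plane $\mathbb P_k^2$. Then either $\mathrm{rt}(X)=1$ or else $\mathrm{rt}(X)\ge 3$.
   Context: Points of $\mathbb P^2_k$ are taken in the classical sense $p=[a:b:c]$ with $a,b,c\in k$ not all zero, so that the homogeneous ideal $I(p)\subseteq R=k[x,y,z]$ of $p$ is a prime ideal generated by two linear forms; $I(X)=\bigcap_{p\in X}I(p)$ is the defining ideal of $X$. Relation type of a standard graded algebra: for a commutative ring $R$ and a standard graded $R$-algebra $A=\bigoplus_{n\ge0}A_n$ (commutative graded, $A_0=R$, generated as an $R$-algebra by finitely many elements $f_1,\ldots,f_m$ of degree $1$), let $\mathcal Q$ be the kernel of the graded surjection $R[T_1,\ldots,T_m]\to A$, $T_i\mapsto f_i$. The relation type $\mathrm{rt}_R(A)$ is the least integer $\ell\ge1$ such that $\mathcal Q$ is generated by its elements of degree at most $\ell$; it does not depend on the chosen generators. Relation type of an ideal: for an ideal $I$ of a Noetherian ring $R$, $\mathrm{rt}_R(I):=\mathrm{rt}_R(R[It])$, where $R[It]=\bigoplus_{n\ge0}I^nt^n\subseteq R[t]$ is the Rees algebra. The relation type of an affine scheme $\mathrm{Spec}(k[x_1,\ldots,x_n]/I)$ is $\mathrm{rt}_{k[x_1,\ldots,x_n]}(I)$. The relation type of a subvariety $X$ of projective space is defined as the relation type of the affine cone over $X$; thus here $\mathrm{rt}(X)=\mathrm{rt}_R(I(X))$ with $R=k[x,y,z]$. *)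

theory Defs
  imports
    "HOL-Analysis.Finite_Cartesian_Product"
    "HOL-Library.Poly_Mapping"
    "HOL-Library.Numeral_Type"
    "HOL-Library.Extended_Nat"
    "HOL-Computational_Algebra.Polynomial"
begin

section \<open>Multivariate polynomials as finitely supported functions\<close>

text \<open>
  A monomial in variables indexed by \<open>'i\<close> is its exponent function \<open>'i \<Rightarrow>\<^sub>0 nat\<close>; with the
  convolution product of \<^theory>\<open>HOL-Library.Poly_Mapping\<close> the type below is the polynomial ring
  over \<open>'r\<close> in these variables. In particular \<open>(3, 'k) mpoly\<close> is \<open>k[x,y,z]\<close>.
\<close>

type_synonym ('i, 'r) mpoly = "('i \<Rightarrow>\<^sub>0 nat) \<Rightarrow>\<^sub>0 'r"

definition mpoly_eval ::
    "('r::comm_ring_1 \<Rightarrow> 'b::comm_ring_1) \<Rightarrow> ('i \<Rightarrow> 'b) \<Rightarrow> ('i, 'r) mpoly \<Rightarrow> 'b" where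
  "mpoly_eval \<phi> f P =
     (\<Sum>m\<in>Poly_Mapping.keys P. \<phi> (Poly_Mapping.lookup P m) *
        (\<Prod>i\<in>Poly_Mapping.keys m. f i ^ Poly_Mapping.lookup m i))"

definition mon_degree :: "('i \<Rightarrow>\<^sub>0 nat) \<Rightarrow> nat" where
  "mon_degree m = (\<Sum>i\<in>Poly_Mapping.keys m. Poly_Mapping.lookup m i)"

definition homogeneous :: "nat \<Rightarrow> ('i, 'r::zero) mpoly \<Rightarrow> bool" where
  "homogeneous d P \<longleftrightarrow> (\<forall>m\<in>Poly_Mapping.keys P. mon_degree m = d)"

text \<open>The subring \<open>R[T\<^sub>0,\<dots>,T\<^bsub>m-1\<^esub>]\<close> of the polynomial ring in countably many variables.\<close>

definition mpolys :: "nat \<Rightarrow> (nat, 'r::zero) mpoly set" where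
  "mpolys m = {P. \<forall>t\<in>Poly_Mapping.keys P. Poly_Mapping.keys t \<subseteq> {..<m}}"


section \<open>Ideals\<close>

lemma module_mult: "module ((*) :: 'a::comm_ring_1 \<Rightarrow> 'a \<Rightarrow> 'a)"
  by unfold_locales (auto simp: algebra_simps)

abbreviation ideal_gen :: "'a::comm_ring_1 set \<Rightarrow> 'a set" where
  "ideal_gen \<equiv> module.span (*)"

text \<open>The ideal of the subring \<open>S\<close> generated by \<open>B \<subseteq> S\<close>.\<close>

definition ideal_gen_in :: "'a::comm_ring_1 set \<Rightarrow> 'a set \<Rightarrow> 'a set" where
  "ideal_gen_in S B = {\<Sum>b\<in>F. c b * b | F c. finite F \<and> F \<subseteq> B \<and> (\<forall>b\<in>F. c b \<in> S)}"

lemma ideal_gen_in_UNIV: "ideal_gen_in UNIV B = ideal_gen B"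
  unfolding ideal_gen_in_def module.span_explicit[OF module_mult] by auto

text \<open>For \<open>n = 0\<close> the only generator is the empty product, so the zeroth power is the whole ring.\<close>

definition ideal_power :: "'a::comm_ring_1 set \<Rightarrow> nat \<Rightarrow> 'a set" where
  "ideal_power I n = ideal_gen {\<Prod>j<n. a j | a. \<forall>j<n. a j \<in> I}"

lemma ideal_power_0: "ideal_power I 0 = UNIV"
proof -
  interpret module "(*) :: 'a \<Rightarrow> 'a \<Rightarrow> 'a" by (rule module_mult)
  have "(1::'a) \<in> ideal_power I 0"
    unfolding ideal_power_def by (rule span_base) auto
  then have "x * 1 \<in> ideal_power I 0" for x :: 'a
    unfolding ideal_power_def by (rule span_scale)
  then show ?thesis by auto
qed


section \<open>Graded algebras and relation type\<close>

text \<open>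
  A graded \<open>R\<close>-algebra is given inside an ambient commutative ring by its structure map
  \<open>\<phi>\<close> and its homogeneous pieces; the algebra itself is the sum of the pieces.
\<close>

definition total :: "(nat \<Rightarrow> 'b::comm_ring_1 set) \<Rightarrow> 'b set" where
  "total A = {\<Sum>n\<le>N. a n | N a. \<forall>n. a n \<in> A n}"

locale graded_algebra =
  fixes \<phi> :: "'r::comm_ring_1 \<Rightarrow> 'b::comm_ring_1" and A :: "nat \<Rightarrow> 'b set"
  assumes hom_one: "\<phi> 1 = 1"
    and hom_add: "\<phi> (r + r') = \<phi> r + \<phi> r'"
    and hom_mult: "\<phi> (r * r') = \<phi> r * \<phi> r'"
    and inj_hom: "inj \<phi>"
    and piece_0: "A 0 = range \<phi>"
    and zero_mem: "0 \<in> A n"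
    and add_mem: "u \<in> A n \<Longrightarrow> v \<in> A n \<Longrightarrow> u + v \<in> A n"
    and mult_mem: "u \<in> A i \<Longrightarrow> v \<in> A j \<Longrightarrow> u * v \<in> A (i + j)"
    and direct: "(\<And>n. a n \<in> A n) \<Longrightarrow> (\<Sum>n\<le>N. a n) = 0 \<Longrightarrow> n \<le> N \<Longrightarrow> a n = 0"

text \<open>
  \<open>f 0, \<dots>, f (m - 1)\<close> are elements of degree one generating the algebra; a graded algebra is
  standard if such a system exists.
\<close>

definition degree_one_generators ::
    "('r::comm_ring_1 \<Rightarrow> 'b::comm_ring_1) \<Rightarrow> (nat \<Rightarrow> 'b set) \<Rightarrow> nat \<Rightarrow> (nat \<Rightarrow> 'b) \<Rightarrow> bool" where
  "degree_one_generators \<phi> A m f \<longleftrightarrow>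
     (\<forall>i<m. f i \<in> A 1) \<and> mpoly_eval \<phi> f ` mpolys m = total A"

definition relations ::
    "('r::comm_ring_1 \<Rightarrow> 'b::comm_ring_1) \<Rightarrow> nat \<Rightarrow> (nat \<Rightarrow> 'b) \<Rightarrow> (nat, 'r) mpoly set" where
  "relations \<phi> m f = {P \<in> mpolys m. mpoly_eval \<phi> f P = 0}"

definition relations_generated_up_to ::
    "('r::comm_ring_1 \<Rightarrow> 'b::comm_ring_1) \<Rightarrow> nat \<Rightarrow> (nat \<Rightarrow> 'b) \<Rightarrow> nat \<Rightarrow> bool" where
  "relations_generated_up_to \<phi> m f l \<longleftrightarrow>
     relations \<phi> m f =
       ideal_gen_in (mpolys m) {P \<in> relations \<phi> m f. \<exists>d\<le>l. homogeneous d P}"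

text \<open>
  Since the least admissible \<open>l\<close> is the same for all finite systems of degree-one generators, the
  infimum may be taken over all of them. It is \<open>\<infinity>\<close> if there is no admissible \<open>l\<close>, which
  cannot happen for a standard graded algebra over a Noetherian ring.
\<close>

definition relation_type ::
    "('r::comm_ring_1 \<Rightarrow> 'b::comm_ring_1) \<Rightarrow> (nat \<Rightarrow> 'b set) \<Rightarrow> enat" where
  "relation_type \<phi> A =
     Inf {enat l | l m f. 1 \<le> l \<and> degree_one_generators \<phi> A m f \<and>
                          relations_generated_up_to \<phi> m f l}"

definition rees_piece :: "'r::comm_ring_1 set \<Rightarrow> nat \<Rightarrow> 'r poly set" where
  "rees_piece I n = {monom a n | a. a \<in> ideal_power I n}"

definition relation_type_ideal :: "'r::comm_ring_1 set \<Rightarrow> enat" where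
  "relation_type_ideal I = relation_type (\<lambda>r. [:r:]) (rees_piece I)"

lemma ideal_power_mult:
  fixes u v :: "'a::comm_ring_1"
  assumes "u \<in> ideal_power I i" "v \<in> ideal_power I j"
  shows "u * v \<in> ideal_power I (i + j)"
proof -
  interpret module "(*) :: 'a \<Rightarrow> 'a \<Rightarrow> 'a" by (rule module_mult)
  have base: "(\<Prod>k<i. a k) * (\<Prod>k<j. b k) \<in> ideal_power I (i + j)"
    if a: "\<forall>k<i. a k \<in> I" and b: "\<forall>k<j. b k \<in> I" for a b
  proof -
    define c where "c k = (if k < i then a k else b (k - i))" for k
    have "(\<Prod>k<i + j. c k) = (\<Prod>k<i. c k) * (\<Prod>k\<in>{i..<i + j}. c k)"
      by (subst prod.union_disjoint[symmetric]) (auto intro!: prod.cong)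
    also have "(\<Prod>k\<in>{i..<i + j}. c k) = (\<Prod>k<j. c (i + k))"
      by (rule prod.reindex_bij_witness[of _ "\<lambda>k. i + k" "\<lambda>k. k - i"]) auto
    finally have "(\<Prod>k<i. a k) * (\<Prod>k<j. b k) = (\<Prod>k<i + j. c k)"
      by (simp add: c_def)
    moreover have "\<forall>k<i + j. c k \<in> I" using a b by (auto simp: c_def)
    ultimately show ?thesis
      unfolding ideal_power_def by (intro span_base) auto
  qed
  have left: "u * (\<Prod>k<j. b k) \<in> ideal_power I (i + j)" if b: "\<forall>k<j. b k \<in> I" for b
    using assms(1) unfolding ideal_power_def[of I i]
  proof (induction rule: span_induct_alt)
    case base
    show ?case by (simp add: ideal_power_def span_zero)
  next
    case (step c x y)
    from step.hyps obtain a where x: "x = (\<Prod>k<i. a k)" and a: "\<forall>k<i. a k \<in> I" by blast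
    have "x * (\<Prod>k<j. b k) \<in> ideal_power I (i + j)" unfolding x by (rule base[OF a b])
    moreover have "y * (\<Prod>k<j. b k) \<in> ideal_power I (i + j)" by (rule step.IH)
    ultimately have "c * (x * (\<Prod>k<j. b k)) + y * (\<Prod>k<j. b k) \<in> ideal_power I (i + j)"
      unfolding ideal_power_def by (rule span_add[OF span_scale])
    then show ?case by (simp only: distrib_left distrib_right mult.assoc mult.left_commute)
  qed
  show ?thesis
    using assms(2) unfolding ideal_power_def[of I j]
  proof (induction rule: span_induct_alt)
    case base
    show ?case by (simp add: ideal_power_def span_zero)
  next
    case (step c x y)
    from step.hyps obtain b where x: "x = (\<Prod>k<j. b k)" and b: "\<forall>k<j. b k \<in> I" by blast
    have "u * x \<in> ideal_power I (i + j)" unfolding x by (rule left[OF b])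
    moreover have "u * y \<in> ideal_power I (i + j)" by (rule step.IH)
    ultimately have "c * (u * x) + u * y \<in> ideal_power I (i + j)"
      unfolding ideal_power_def by (rule span_add[OF span_scale])
    then show ?case by (simp only: distrib_left distrib_right mult.assoc mult.left_commute)
  qed
qed

lemma graded_algebra_rees: "graded_algebra (\<lambda>r. [:r:]) (rees_piece (I :: 'r::comm_ring_1 set))"
proof -
  interpret module "(*) :: 'r \<Rightarrow> 'r \<Rightarrow> 'r" by (rule module_mult)
  show ?thesis
  proof
    show "rees_piece I 0 = range (\<lambda>r. [:r:])"
      by (auto simp: rees_piece_def ideal_power_0 monom_0)
    show "0 \<in> rees_piece I n" for n
      by (auto simp: rees_piece_def ideal_power_def intro!: exI[of _ 0] span_zero)
    show "u + v \<in> rees_piece I n" if uv: "u \<in> rees_piece I n" "v \<in> rees_piece I n" for u v n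
    proof -
      obtain a b where "u = monom a n" "v = monom b n" "a \<in> ideal_power I n" "b \<in> ideal_power I n"
        using uv unfolding rees_piece_def by blast
      moreover from this have "a + b \<in> ideal_power I n"
        unfolding ideal_power_def by (intro span_add)
      ultimately show ?thesis by (auto simp: rees_piece_def add_monom)
    qed
    show "u * v \<in> rees_piece I (i + j)"
      if uv: "u \<in> rees_piece I i" "v \<in> rees_piece I j" for u v i j
    proof -
      obtain a b where "u = monom a i" "v = monom b j" "a \<in> ideal_power I i" "b \<in> ideal_power I j"
        using uv unfolding rees_piece_def by blast
      moreover from this have "a * b \<in> ideal_power I (i + j)" by (intro ideal_power_mult)
      ultimately show ?thesis by (auto simp: rees_piece_def mult_monom)
    qed
    show "a n = 0"
      if a: "\<And>n. a n \<in> rees_piece I n" and s: "(\<Sum>n\<le>N. a n) = 0" and n: "n \<le> N" for a N n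
    proof -
      have "\<forall>n. \<exists>b. a n = monom b n" using a unfolding rees_piece_def by blast
      then obtain b where b: "a n = monom (b n) n" for n by metis
      have "coeff (\<Sum>n\<le>N. a n) n = b n"
        using n by (simp add: b coeff_sum)
      with s show ?thesis by (simp add: b)
    qed
  qed (auto simp: inj_def)
qed


section \<open>Points of the projective plane\<close>

definition proj_rel :: "((('k::field) ^ 3) \<times> ('k ^ 3)) set" where
  "proj_rel = {(u, v). u \<noteq> 0 \<and> v \<noteq> 0 \<and> (\<exists>c. c \<noteq> 0 \<and> v = c *s u)}"

definition proj_plane :: "('k::field ^ 3) set set" where
  "proj_plane = (UNIV - {0}) // proj_rel"

lemma equiv_proj_rel: "equiv (UNIV - {0}) (proj_rel :: (('k::field ^ 3) \<times> _) set)"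
proof (rule equivI)
  show "proj_rel \<subseteq> (UNIV - {0}) \<times> (UNIV - {0} :: ('k ^ 3) set)"
    by (auto simp: proj_rel_def)
  show "refl_on (UNIV - {0}) (proj_rel :: (('k ^ 3) \<times> _) set)"
    by (auto simp: refl_on_def proj_rel_def intro!: exI[of _ 1])
  show "sym (proj_rel :: (('k ^ 3) \<times> _) set)"
  proof (rule symI)
    fix u v :: "'k ^ 3"
    assume "(u, v) \<in> proj_rel"
    then obtain c where "u \<noteq> 0" "v \<noteq> 0" "c \<noteq> 0" "v = c *s u" by (auto simp: proj_rel_def)
    then show "(v, u) \<in> proj_rel"
      by (auto simp: proj_rel_def vector_smult_assoc intro!: exI[of _ "inverse c"])
  qed
  show "trans (proj_rel :: (('k ^ 3) \<times> _) set)"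
  proof (rule transI)
    fix u v w :: "'k ^ 3"
    assume uv: "(u, v) \<in> proj_rel" and vw: "(v, w) \<in> proj_rel"
    obtain c where "u \<noteq> 0" "c \<noteq> 0" "v = c *s u"
      using uv unfolding proj_rel_def by blast
    moreover obtain d where "w \<noteq> 0" "d \<noteq> 0" "w = d *s v"
      using vw unfolding proj_rel_def by blast
    ultimately have "u \<noteq> 0" "w \<noteq> 0" "d * c \<noteq> 0" "w = (d * c) *s u"
      by (simp_all add: vector_smult_assoc)
    then show "(u, w) \<in> proj_rel"
      unfolding proj_rel_def by blast
  qed
qed

text \<open>
  A homogeneous form vanishes at one representative of a point iff it vanishes at all of them.
  Restricting to homogeneous forms matters: over a finite field, non-homogeneous polynomials can
  vanish on all representatives.
\<close>

definition point_ideal :: "('k::field ^ 3) set \<Rightarrow> (3, 'k) mpoly set" where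
  "point_ideal p =
     ideal_gen {F. (\<exists>d. homogeneous d F) \<and> (\<forall>v\<in>p. mpoly_eval id (\<lambda>i. v $ i) F = 0)}"

text \<open>For \<open>X = {}\<close> this is the whole ring.\<close>

definition vanishing_ideal :: "('k::field ^ 3) set set \<Rightarrow> (3, 'k) mpoly set" where
  "vanishing_ideal X = (\<Inter>p\<in>X. point_ideal p)"

definition rt :: "('k::field ^ 3) set set \<Rightarrow> enat" where
  "rt X = relation_type_ideal (vanishing_ideal X)"

end

theory Submission
  imports Defs "HOL-Analysis.Cartesian_Space" "HOL-Library.Function_Algebras"
begin

text \<open>
  Let \<open>R = k[x,y,z]\<close>, let \<open>I\<close> be the ideal of \<open>X\<close>, and let \<open>f\<close> be a finite system of generators
  of \<open>I\<close>. If the relations of the Rees algebra are generated in degrees at most two, then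
  they are already generated in degree one, because \<open>I\<close> is syzygetic: every quadratic
  relation between the \<open>f\<^sub>i\<close> is a combination of products of a linear form and a linear relation
  (\<open>vanishing_ideal_syzygetic\<close>). So relation type two is impossible.

  In homological terms, let \<open>G\<close> be the free module on the generators and \<open>F \<subseteq> G\<close> their module of
  syzygies. If \<open>X\<close> is nonempty, then \<open>R/I\<close> has depth one, so \<open>F\<close> is free and
  \<open>0 \<rightarrow> \<And>\<^sup>2 F \<rightarrow> F \<otimes> G \<rightarrow> S\<^sup>2 G \<rightarrow> S\<^sup>2 I \<rightarrow> 0\<close> shows that \<open>S\<^sup>2 I\<close> has depth at least one. The
  kernel of \<open>S\<^sup>2 I \<rightarrow> I\<^sup>2\<close> vanishes away from \<open>X\<close>, where \<open>I\<close> is locally the unit ideal, and at each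
  point of \<open>X\<close>, where \<open>I\<close> is locally a complete intersection. So it is supported at the irrelevant
  ideal, and hence it is zero. The proof below is an elementary form of this argument. Its
  ingredients are the following.

  \<^item> Freeness (\<open>syz_free\<close>). Homogeneous syzygies that form a vector space basis of
    \<open>F\<close> modulo \<open>(x, y, z) F\<close> generate \<open>F\<close>. They are independent because the first homology of the Koszul
    complex of \<open>x, y, z\<close> on \<open>F\<close> vanishes, and this holds because \<open>R/I\<close> has no socle. Homogeneous
    generators of \<open>I\<close> are needed here; \<open>quadric_relations_change_generators\<close> allows passing to the
    homogeneous components of the \<open>f\<^sub>i\<close>.

  \<^item> The local statement (\<open>quadric_relation_local\<close>). If \<open>g\<close> vanishes at all points of \<open>X\<close>
    except \<open>p\<close>, where it does not, then \<open>g\<^sup>2\<close> kills the class of every quadratic relation in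
    \<open>S\<^sup>2 I\<close>. The sum \<open>h\<close> of such \<open>g\<^sup>2\<close>, one for each point of \<open>X\<close>, is a nonzerodivisor on \<open>R/I\<close> that kills this class too.

  \<^item> Torsion-freeness (\<open>syz_products_torsion_free\<close>). If \<open>F\<close> is free and \<open>h\<close> is a nonzerodivisor on
    \<open>R/I\<close>, then \<open>h\<close> is a nonzerodivisor on \<open>S\<^sup>2 I\<close>. The proof uses that \<open>I\<close> has grade at least two,
    in the form of \<open>vanishing_ideal_grade\<close>.

  The element \<open>h\<close> takes the role of a linear form that avoids all points of \<open>X\<close>; over a finite field
  such a form need not exist.
\<close>

section \<open>Polynomials as generated by constants and variables\<close>

interpretation ideal: module "(*) :: 'a::comm_ring_1 \<Rightarrow> 'a \<Rightarrow> 'a"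
  by (rule module_mult)

\<comment> \<open>As a rewrite rule it works against associativity of the product.\<close>
declare ideal.scale_scale [simp del]

definition Cst :: "'r::zero \<Rightarrow> ('i, 'r) mpoly" where
  "Cst c = Poly_Mapping.single 0 c"

definition Var :: "'i \<Rightarrow> ('i, 'r::zero_neq_one) mpoly" where
  "Var i = Poly_Mapping.single (Poly_Mapping.single i 1) 1"

lemma Cst_0 [simp]: "Cst 0 = 0"
  and Cst_1 [simp]: "Cst (1::'r::comm_ring_1) = 1"
  and Cst_add: "Cst (a + b :: 'r) = Cst a + Cst b"
  and Cst_mult: "Cst (a * b :: 'r) = Cst a * Cst b"
  and Cst_uminus: "Cst (- a :: 'r) = - Cst a"
  and Cst_diff: "Cst (a - b :: 'r) = Cst a - Cst b"
  by (simp_all add: Cst_def single_add single_uminus single_diff mult_single)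

lemma Cst_sum: "Cst (\<Sum>x\<in>A. f x :: 'r::comm_ring_1) = (\<Sum>x\<in>A. Cst (f x))"
  by (induction A rule: infinite_finite_induct) (auto simp: Cst_add)

lemma lookup_Cst_mult: "Poly_Mapping.lookup (Cst c * P) m = (c :: 'r::comm_ring_1) * Poly_Mapping.lookup P m"
proof -
  have "Cst c * P = Poly_Mapping.map ((*) c) P"
    by (simp add: Cst_def mult_map_scale_conv_mult)
  then show ?thesis by (simp add: Poly_Mapping.map.rep_eq when_def)
qed

lemma Cst_mult_cancel:
  fixes c :: "'r::idom"
  assumes "c \<noteq> 0" "Cst c * P = Cst c * Q"
  shows "P = Q"
proof (rule poly_mapping_eqI)
  fix m
  have "Poly_Mapping.lookup (Cst c * P) m = Poly_Mapping.lookup (Cst c * Q) m"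
    using assms(2) by simp
  then show "Poly_Mapping.lookup P m = Poly_Mapping.lookup Q m"
    using assms(1) by (simp add: lookup_Cst_mult)
qed

lemma poly_mapping_sum_single:
  "P = (\<Sum>m\<in>Poly_Mapping.keys P. Poly_Mapping.single m (Poly_Mapping.lookup P m))"
  by (rule poly_mapping_eqI)
    (auto simp: lookup_sum lookup_single when_def in_keys_iff sum.delta')

lemma poly_mapping_additive_induct [case_names single add]:
  assumes "\<And>m c. P (Poly_Mapping.single m c)"
    and "\<And>F G. P F \<Longrightarrow> P G \<Longrightarrow> P (F + G)"
  shows "P (F :: 'a \<Rightarrow>\<^sub>0 'b::comm_monoid_add)"
proof -
  have "P (\<Sum>m\<in>A. Poly_Mapping.single m (Poly_Mapping.lookup F m))" if "finite A" for A
    using that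
  proof (induction A)
    case empty
    show ?case using assms(1)[of undefined 0] by simp
  next
    case (insert x A)
    then show ?case by (simp add: assms)
  qed
  then show ?thesis by (subst poly_mapping_sum_single) simp
qed

text \<open>
  Statements about ring homomorphisms on polynomials reduce in this way to constants and variables;
  no computation with coefficients is needed afterwards.
\<close>

lemma mpoly_induct [case_names Cst Var add mult]:
  assumes Cst: "\<And>c. P (Cst c)" and Var: "\<And>i. P (Var i)"
    and add: "\<And>F G. P F \<Longrightarrow> P G \<Longrightarrow> P (F + G)"
    and mult: "\<And>F G. P F \<Longrightarrow> P G \<Longrightarrow> P (F * G)"
  shows "P (F :: ('i, 'r::comm_ring_1) mpoly)"
proof (induction F rule: poly_mapping_additive_induct)
  case (single m c)
  have mon: "P (Poly_Mapping.single m 1)"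
  proof (induction m rule: poly_mapping_additive_induct)
    case (single i n)
    show ?case
    proof (induction n)
      case 0
      show ?case using Cst[of 1] by (simp add: Cst_def)
    next
      case (Suc n)
      have "Poly_Mapping.single (Poly_Mapping.single i (Suc n)) 1
          = Var i * Poly_Mapping.single (Poly_Mapping.single i n) (1::'r)"
        by (simp add: Var_def mult_single flip: single_add)
      then show ?case using Suc by (simp add: Var mult)
    qed
  next
    case (add m m')
    have "Poly_Mapping.single (m + m') 1
        = Poly_Mapping.single m 1 * Poly_Mapping.single m' (1::'r)"
      by (simp add: mult_single)
    then show ?case using add by (simp add: mult)
  qed
  have "Poly_Mapping.single m c = Cst c * Poly_Mapping.single m 1"
    by (simp add: Cst_def mult_single)
  then show ?case using mon by (simp add: Cst mult)
qed (rule add)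

definition mon_val :: "('i \<Rightarrow> 'b::comm_ring_1) \<Rightarrow> ('i \<Rightarrow>\<^sub>0 nat) \<Rightarrow> 'b" where
  "mon_val f m = (\<Prod>i\<in>Poly_Mapping.keys m. f i ^ Poly_Mapping.lookup m i)"

lemma mon_val_superset:
  assumes "finite A" "Poly_Mapping.keys m \<subseteq> A"
  shows "mon_val f m = (\<Prod>i\<in>A. f i ^ Poly_Mapping.lookup m i)"
  unfolding mon_val_def using assms
  by (intro prod.mono_neutral_left) (auto simp: in_keys_iff)

lemma mon_val_add: "mon_val f (m + m') = mon_val f m * mon_val f m'"
proof -
  let ?A = "Poly_Mapping.keys m \<union> Poly_Mapping.keys m'"
  have "Poly_Mapping.keys (m + m') \<subseteq> ?A" by (rule keys_add)
  then show ?thesis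
    by (simp add: mon_val_superset[of ?A] lookup_add power_add prod.distrib)
qed

lemma mon_val_0 [simp]: "mon_val f 0 = 1"
  by (simp add: mon_val_def)

lemma mon_val_single: "mon_val f (Poly_Mapping.single i n) = f i ^ n"
  by (cases "n = 0") (simp_all add: mon_val_def)

locale coeff_hom =
  fixes \<phi> :: "'r::comm_ring_1 \<Rightarrow> 'b::comm_ring_1"
  assumes hom_1: "\<phi> 1 = 1" and hom_plus: "\<phi> (x + y) = \<phi> x + \<phi> y"
    and hom_times: "\<phi> (x * y) = \<phi> x * \<phi> y"
begin

lemma hom_0: "\<phi> 0 = 0"
  using hom_plus[of 0 0] by simp

lemma eval_superset:
  assumes "finite A" "Poly_Mapping.keys P \<subseteq> A"
  shows "mpoly_eval \<phi> f P = (\<Sum>m\<in>A. \<phi> (Poly_Mapping.lookup P m) * mon_val f m)"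
  unfolding mpoly_eval_def mon_val_def[symmetric] using assms
  by (intro sum.mono_neutral_left) (auto simp: in_keys_iff hom_0)

lemma eval_add: "mpoly_eval \<phi> f (P + Q) = mpoly_eval \<phi> f P + mpoly_eval \<phi> f Q"
proof -
  let ?A = "Poly_Mapping.keys P \<union> Poly_Mapping.keys Q"
  have "Poly_Mapping.keys (P + Q) \<subseteq> ?A" by (rule keys_add)
  then show ?thesis
    by (simp add: eval_superset[of ?A] lookup_add hom_plus distrib_right sum.distrib)
qed

lemma eval_single: "mpoly_eval \<phi> f (Poly_Mapping.single m c) = \<phi> c * mon_val f m"
  by (subst eval_superset[of "{m}"]) auto

lemma eval_mult: "mpoly_eval \<phi> f (P * Q) = mpoly_eval \<phi> f P * mpoly_eval \<phi> f Q"
proof (induction P rule: poly_mapping_additive_induct)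
  case (single m c)
  show ?case
  proof (induction Q rule: poly_mapping_additive_induct)
    case (single m' c')
    show ?case by (simp add: mult_single eval_single hom_times mon_val_add mult_ac)
  qed (simp add: eval_add algebra_simps)
qed (simp add: eval_add algebra_simps)

lemma eval_Cst: "mpoly_eval \<phi> f (Cst c) = \<phi> c"
  by (simp add: Cst_def eval_single)

lemma eval_Var: "mpoly_eval \<phi> f (Var i) = f i"
  by (simp add: Var_def eval_single mon_val_single hom_1)

lemma eval_0: "mpoly_eval \<phi> f 0 = 0"
  using eval_Cst[of f 0] by (simp add: hom_0)

lemma eval_1: "mpoly_eval \<phi> f 1 = 1"
  using eval_Cst[of f 1] by (simp add: hom_1)

lemma eval_uminus: "mpoly_eval \<phi> f (- P) = - mpoly_eval \<phi> f P"
  using eval_add[of f P "- P"] by (simp add: eval_0 eq_neg_iff_add_eq_0 add.commute)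

lemma eval_diff: "mpoly_eval \<phi> f (P - Q) = mpoly_eval \<phi> f P - mpoly_eval \<phi> f Q"
  using eval_add[of f P "- Q"] by (simp add: eval_uminus)

lemma eval_sum: "mpoly_eval \<phi> f (\<Sum>x\<in>A. P x) = (\<Sum>x\<in>A. mpoly_eval \<phi> f (P x))"
  by (induction A rule: infinite_finite_induct) (simp_all add: eval_0 eval_add)

lemmas eval_simps = eval_add eval_mult eval_Cst eval_Var eval_0 eval_1 eval_uminus eval_diff eval_sum

end

abbreviation eval :: "('i \<Rightarrow> 'r::comm_ring_1) \<Rightarrow> ('i, 'r) mpoly \<Rightarrow> 'r" where
  "eval \<equiv> mpoly_eval (\<lambda>r. r)"

abbreviation subst :: "('i \<Rightarrow> ('j, 'r::comm_ring_1) mpoly) \<Rightarrow> ('i, 'r) mpoly \<Rightarrow> ('j, 'r) mpoly" where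
  "subst \<equiv> mpoly_eval Cst"

interpretation eval: coeff_hom "\<lambda>r :: 'r::comm_ring_1. r"
  by unfold_locales auto

interpretation subst: coeff_hom "Cst :: 'r::comm_ring_1 \<Rightarrow> ('j, 'r) mpoly"
  by unfold_locales (auto simp: Cst_add Cst_mult)

interpretation rees: coeff_hom "\<lambda>r :: 'r::comm_ring_1. [:r:]"
  by unfold_locales auto

text \<open>
  Substituting congruent elements for the variables does not change a polynomial modulo an ideal.
  For a substitution that kills some linear forms this is division with remainder by these forms: a
  polynomial in the kernel of the substitution is a combination of them.
\<close>

lemma subst_congruent_mod:
  fixes s :: "'i \<Rightarrow> ('i, 'r::comm_ring_1) mpoly"
  assumes "\<And>i. Var i - s i \<in> ideal_gen J"
  shows "F - subst s F \<in> ideal_gen J"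
proof (induction F rule: mpoly_induct)
  case (Cst c)
  show ?case by (simp add: subst.eval_simps ideal.span_zero)
next
  case (Var i)
  show ?case by (simp add: subst.eval_simps assms)
next
  case (add F G)
  have "F + G - subst s (F + G) = (F - subst s F) + (G - subst s G)"
    by (simp add: subst.eval_simps)
  then show ?case using add by (simp only: ideal.span_add)
next
  case (mult F G)
  have "F * G - subst s (F * G) = G * (F - subst s F) + subst s F * (G - subst s G)"
    by (simp add: subst.eval_simps algebra_simps)
  then show ?case using mult by (simp only: ideal.span_add ideal.span_scale)
qed

lemma ideal_gen_1: "x \<in> ideal_gen {a} \<longleftrightarrow> a dvd x"
  by (auto simp: ideal.span_singleton dvd_def mult.commute)

lemma ideal_gen_2: "x \<in> ideal_gen {a, b} \<longleftrightarrow> (\<exists>u v. x = u * a + v * b)"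
proof -
  have "x \<in> ideal_gen {a, b} \<longleftrightarrow> (\<exists>u v. x - u * a = v * b)"
    by (auto simp: ideal.span_insert[of a "{b}"] ideal.span_singleton)
  then show ?thesis by (simp add: algebra_simps)
qed

lemma ideal_gen_3: "x \<in> ideal_gen {a, b, c} \<longleftrightarrow> (\<exists>u v w. x = u * a + v * b + w * c)"
proof -
  have "x \<in> ideal_gen {a, b, c} \<longleftrightarrow> (\<exists>u. x - u * a \<in> ideal_gen {b, c})"
    by (auto simp: ideal.span_insert[of a "{b, c}"])
  then show ?thesis by (simp add: ideal_gen_2 algebra_simps)
qed

section \<open>Homogeneous components\<close>

lemma mon_degree_superset:
  assumes "finite A" "Poly_Mapping.keys m \<subseteq> A"
  shows "mon_degree m = (\<Sum>i\<in>A. Poly_Mapping.lookup m i)"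
  unfolding mon_degree_def using assms
  by (intro sum.mono_neutral_left) (auto simp: in_keys_iff)

lemma mon_degree_add: "mon_degree (m + m') = mon_degree m + mon_degree m'"
proof -
  let ?A = "Poly_Mapping.keys m \<union> Poly_Mapping.keys m'"
  have "Poly_Mapping.keys (m + m') \<subseteq> ?A" by (rule keys_add)
  then show ?thesis
    by (simp add: mon_degree_superset[of ?A] lookup_add sum.distrib)
qed

lemma mon_degree_0 [simp]: "mon_degree 0 = 0"
  by (simp add: mon_degree_def)

lemma mon_degree_single [simp]: "mon_degree (Poly_Mapping.single i n) = n"
  by (cases "n = 0") (simp_all add: mon_degree_def)

lemma keys_Var [simp]: "Poly_Mapping.keys (Var i :: ('i, 'r::zero_neq_one) mpoly) = {Poly_Mapping.single i 1}"
  by (simp add: Var_def)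

lemma (in coeff_hom) mon_val_scaled:
  "mon_val (\<lambda>i. \<phi> (a i) * y) m = \<phi> (mon_val a m) * y ^ mon_degree m"
proof (induction m rule: poly_mapping_additive_induct)
  case (single i n)
  have "\<phi> (a i) ^ n = \<phi> (a i ^ n)" by (induction n) (simp_all add: hom_1 hom_times)
  then show ?case by (simp add: mon_val_single power_mult_distrib)
next
  case (add m m')
  then show ?case by (simp add: mon_val_add mon_degree_add hom_times power_add algebra_simps)
qed

text \<open>
  With \<open>y\<close> a variable this computes values in a Rees algebra and on the line through a point; with a scalar \<open>y\<close> it is independence of the choice of
  homogeneous coordinates.
\<close>

lemma (in coeff_hom) eval_homogeneous_scaled:
  assumes "homogeneous d P"
  shows "mpoly_eval \<phi> (\<lambda>i. \<phi> (a i) * y) P = \<phi> (eval a P) * y ^ d"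
proof -
  have hom_sum: "\<phi> (\<Sum>x\<in>A. f x) = (\<Sum>x\<in>A. \<phi> (f x))" for f :: "'c \<Rightarrow> 'r" and A
    by (induction A rule: infinite_finite_induct) (simp_all add: hom_0 hom_plus)
  have "mpoly_eval \<phi> (\<lambda>i. \<phi> (a i) * y) P
      = (\<Sum>m\<in>Poly_Mapping.keys P. \<phi> (Poly_Mapping.lookup P m * mon_val a m) * y ^ d)"
    unfolding mpoly_eval_def mon_val_def[symmetric] mon_val_scaled
    using assms by (intro sum.cong) (auto simp: homogeneous_def hom_times mult.assoc)
  also have "\<dots> = \<phi> (eval a P) * y ^ d"
    unfolding mpoly_eval_def mon_val_def[symmetric] by (simp add: hom_sum sum_distrib_right)
  finally show ?thesis .
qed

text \<open>
  Homogeneous components with respect to the standard grading and to the shifted gradings of a free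
  module are both obtained by selecting monomials.
\<close>

definition restr :: "('m \<Rightarrow> bool) \<Rightarrow> ('m \<Rightarrow>\<^sub>0 'r::zero) \<Rightarrow> ('m \<Rightarrow>\<^sub>0 'r)" where
  "restr Q P = Poly_Mapping.mapp (\<lambda>m c. if Q m then c else 0) P"

lemma lookup_restr: "Poly_Mapping.lookup (restr Q P) m = (if Q m then Poly_Mapping.lookup P m else 0)"
  by (auto simp: restr_def lookup_mapp when_def in_keys_iff)

lemma restr_0 [simp]: "restr Q 0 = 0"
  by (rule poly_mapping_eqI) (simp add: lookup_restr)

lemma restr_add: "restr Q (F + G) = restr Q F + restr Q (G :: _ \<Rightarrow>\<^sub>0 'r::comm_ring_1)"
  by (rule poly_mapping_eqI) (simp add: lookup_restr lookup_add)

lemma restr_sum: "restr Q (\<Sum>x\<in>A. F x) = (\<Sum>x\<in>A. restr Q (F x :: _ \<Rightarrow>\<^sub>0 'r::comm_ring_1))"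
  by (induction A rule: infinite_finite_induct) (simp_all add: restr_add)

lemma keys_restr: "Poly_Mapping.keys (restr Q P) = {m \<in> Poly_Mapping.keys P. Q m}"
  by (auto simp: in_keys_iff lookup_restr split: if_splits)

lemma restr_id: "(\<And>m. m \<in> Poly_Mapping.keys P \<Longrightarrow> Q m) \<Longrightarrow> restr Q P = P"
  by (rule poly_mapping_eqI) (auto simp: lookup_restr in_keys_iff)

lemma restr_eq_0: "(\<And>m. m \<in> Poly_Mapping.keys P \<Longrightarrow> \<not> Q m) \<Longrightarrow> restr Q P = 0"
  by (rule poly_mapping_eqI) (auto simp: lookup_restr in_keys_iff)

lemma restr_single: "restr Q (Poly_Mapping.single m c) = (if Q m then Poly_Mapping.single m c else 0)"
  by (rule poly_mapping_eqI) (auto simp: lookup_restr lookup_single when_def)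

text \<open>
  The factor \<open>A\<close> may be any polynomial all of whose monomials shift the selected set in the same way,
  in particular a variable or a homogeneous polynomial.
\<close>

lemma restr_mult:
  fixes A P :: "'m::comm_monoid_add \<Rightarrow>\<^sub>0 'r::comm_ring_1"
  assumes "\<And>k m. k \<in> Poly_Mapping.keys A \<Longrightarrow> Q (k + m) = Q' m"
  shows "restr Q (A * P) = A * restr Q' P"
proof -
  have mono: "restr Q (Poly_Mapping.single k c * P) = Poly_Mapping.single k c * restr Q' P"
    if "k \<in> Poly_Mapping.keys A" for k c
    by (induction P rule: poly_mapping_additive_induct)
      (simp_all add: mult_single restr_single assms[OF that] restr_add distrib_left)
  have "restr Q ((\<Sum>k\<in>Poly_Mapping.keys A. Poly_Mapping.single k (Poly_Mapping.lookup A k)) * P)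
      = (\<Sum>k\<in>Poly_Mapping.keys A. Poly_Mapping.single k (Poly_Mapping.lookup A k)) * restr Q' P"
    by (simp add: sum_distrib_right restr_sum mono)
  then show ?thesis by (simp flip: poly_mapping_sum_single)
qed

lemma restr_sum_degrees:
  fixes P :: "_ \<Rightarrow>\<^sub>0 'r::comm_ring_1"
  assumes *: "\<And>m. m \<in> Poly_Mapping.keys P \<Longrightarrow> f m \<le> (N::nat)"
  shows "(\<Sum>n\<le>N. restr (\<lambda>m. f m = n) P) = P"
proof (rule poly_mapping_eqI)
  fix m
  show "Poly_Mapping.lookup (\<Sum>n\<le>N. restr (\<lambda>m. f m = n) P) m = Poly_Mapping.lookup P m"
    using assms[of m] by (auto simp: lookup_sum lookup_restr in_keys_iff sum.delta)
qed

abbreviation hcomp :: "nat \<Rightarrow> ('i, 'r::zero) mpoly \<Rightarrow> ('i, 'r) mpoly" where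
  "hcomp d \<equiv> restr (\<lambda>m. mon_degree m = d)"

lemma homogeneous_hcomp: "homogeneous d (hcomp d P)"
  by (simp add: homogeneous_def keys_restr)

lemma hcomp_homogeneous: "homogeneous d F \<Longrightarrow> hcomp e F = (if e = d then F else 0)"
  by (auto simp: homogeneous_def intro: restr_id restr_eq_0)

lemma sum_hcomp:
  obtains N where "\<And>n. N \<le> n \<Longrightarrow> (\<Sum>d\<le>n. hcomp d P) = (P :: ('i, 'r::comm_ring_1) mpoly)"
proof
  fix n assume n: "Max (insert 0 (mon_degree ` Poly_Mapping.keys P)) \<le> n"
  show "(\<Sum>d\<le>n. hcomp d P) = P"
  proof (rule restr_sum_degrees)
    fix m assume "m \<in> Poly_Mapping.keys P"
    then have "mon_degree m \<le> Max (insert 0 (mon_degree ` Poly_Mapping.keys P))"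
      by (intro Max_ge) auto
    with n show "mon_degree m \<le> n" by (rule order_trans[rotated])
  qed
qed

text \<open>
  Evaluation on the line \<open>t \<mapsto> t a\<close>; the powers of \<open>t\<close> keep the homogeneous components apart.
\<close>

lemma coeff_eval_cone:
  "coeff (mpoly_eval (\<lambda>r. [:r:]) (\<lambda>i. monom (a i) 1) P) d = eval a (hcomp d P)"
proof -
  obtain N where N: "\<And>n. N \<le> n \<Longrightarrow> (\<Sum>d\<le>n. hcomp d P) = P"
    using sum_hcomp by blast
  have "(\<lambda>i. monom (a i) 1) = (\<lambda>i. [:a i:] * monom 1 1)"
    by (simp add: smult_monom)
  then have hom: "mpoly_eval (\<lambda>r. [:r:]) (\<lambda>i. monom (a i) 1) (hcomp e P) = monom (eval a (hcomp e P)) e" for e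
    using rees.eval_homogeneous_scaled[OF homogeneous_hcomp, of a "monom 1 1" e P]
    by (simp only:) (simp add: monom_power smult_monom)
  have "mpoly_eval (\<lambda>r. [:r:]) (\<lambda>i. monom (a i) 1) P
      = mpoly_eval (\<lambda>r. [:r:]) (\<lambda>i. monom (a i) 1) (\<Sum>e\<le>N + d. hcomp e P)"
    by (simp only: N[of "N + d"] le_add1)
  also have "\<dots> = (\<Sum>e\<le>N + d. monom (eval a (hcomp e P)) e)"
    unfolding rees.eval_sum hom ..
  finally show ?thesis by (simp add: coeff_sum sum.delta)
qed

section \<open>The Koszul complex of the variables\<close>

lemma Var_neq_0: "Var i \<noteq> (0 :: ('i, 'r::comm_ring_1) mpoly)"
  by (metis keys_Var keys_zero insert_not_empty)

lemma Var_dvd_cancel: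
  fixes P :: "('i::linorder, 'r::idom) mpoly"
  assumes "i \<noteq> j" "Var i dvd Var j * P"
  shows "Var i dvd P"
proof -
  let ?s = "\<lambda>k. if k = i then 0 else Var k :: ('i, 'r) mpoly"
  have "Var k - ?s k \<in> ideal_gen {Var i}" for k
    by (simp add: ideal_gen_1)
  then have "P - subst ?s P \<in> ideal_gen {Var i}"
    by (rule subst_congruent_mod)
  moreover obtain Q where "Var j * P = Var i * Q" using assms(2) by (elim dvdE)
  then have "subst ?s (Var j * P) = subst ?s (Var i * Q)" by simp
  then have "subst ?s P = 0"
    using assms(1) by (simp add: subst.eval_simps Var_neq_0)
  ultimately show ?thesis by (simp add: ideal_gen_1)
qed

text \<open>
  Exactness of the Koszul complex of three variables at the place of the vectors \<open>(u, v, w)\<close>. It comes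
  from the regularity of the sequence: the third variable is regular modulo the first two, which
  determines \<open>w\<close>, and then the second one is regular modulo the first, which determines \<open>v\<close>.
\<close>

lemma Var_koszul_exact:
  fixes u v w :: "('i::linorder, 'r::idom) mpoly"
  assumes ij: "i \<noteq> j" "i \<noteq> k" "j \<noteq> k" and 0: "Var i * u + Var j * v + Var k * w = 0"
  obtains \<alpha> \<beta> \<gamma> where "u = Var j * \<alpha> + Var k * \<beta>" "v = - (Var i * \<alpha>) + Var k * \<gamma>"
    "w = - (Var i * \<beta>) - Var j * \<gamma>"
proof -
  let ?s = "\<lambda>l. if l = i \<or> l = j then 0 else Var l :: ('i, 'r) mpoly"
  have "Var l - ?s l \<in> ideal_gen {Var i, Var j}" for l
    by (auto intro: ideal.span_base simp: ideal.span_zero)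
  then have "w - subst ?s w \<in> ideal_gen {Var i, Var j}"
    by (rule subst_congruent_mod)
  moreover have "subst ?s (Var i * u + Var j * v + Var k * w) = subst ?s 0" using 0 by simp
  then have "subst ?s w = 0"
    using ij by (simp add: subst.eval_simps Var_neq_0 split: if_splits)
  ultimately obtain b c where w: "w = b * Var i + c * Var j" by (auto simp: ideal_gen_2)
  have *: "Var i * (u + Var k * b) = Var j * (- v - Var k * c)"
  proof -
    have "Var i * (u + Var k * b) - Var j * (- v - Var k * c) = Var i * u + Var j * v + Var k * w"
      by (simp add: w algebra_simps)
    then show ?thesis using 0 by simp
  qed
  then have "Var i dvd - v - Var k * c" using Var_dvd_cancel[OF ij(1)] by (metis dvd_triv_left)
  then obtain a where a: "- v - Var k * c = Var i * a" by (elim dvdE)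
  have "Var i * (u + Var k * b) = Var i * (Var j * a)"
    unfolding * a by (simp only: mult.left_commute)
  then have "u + Var k * b = Var j * a" by (simp add: Var_neq_0)
  then have "u = Var j * a + Var k * (- b)" by (simp add: algebra_simps)
  moreover have "v = - (- v - Var k * c) + Var k * (- c)" by (simp add: algebra_simps)
  then have "v = - (Var i * a) + Var k * (- c)" by (simp only: a)
  moreover have "w = - (Var i * (- b)) - Var j * (- c)" by (simp add: w algebra_simps)
  ultimately show ?thesis by (rule that)
qed

text \<open>
  Exactness one step further, where the cycles are the multiples of the vector of variables.
\<close>

lemma Var_koszul_exact_2:
  fixes \<alpha> \<beta> \<gamma> :: "('i::linorder, 'r::idom) mpoly"
  assumes ij: "i \<noteq> j" "i \<noteq> k" "j \<noteq> k"
    and "Var j * \<alpha> + Var k * \<beta> = 0" "- (Var i * \<alpha>) + Var k * \<gamma> = 0"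
  obtains t where "\<alpha> = Var k * t" "\<beta> = - (Var j * t)" "\<gamma> = Var i * t"
proof -
  have "Var j * \<alpha> = Var k * (- \<beta>)" using assms(4) by (simp add: add_eq_0_iff)
  then have "Var k dvd \<alpha>" using Var_dvd_cancel[of k j \<alpha>] ij by (metis dvd_triv_left)
  then obtain t where t: "\<alpha> = Var k * t" by (elim dvdE)
  have "Var k * (Var j * t + \<beta>) = 0" using assms(4) by (simp add: t algebra_simps)
  then have "\<beta> = - (Var j * t)" by (simp add: Var_neq_0 add_eq_0_iff)
  moreover have "Var k * (- (Var i * t) + \<gamma>) = 0" using assms(5) by (simp add: t algebra_simps)
  then have "\<gamma> = Var i * t" by (simp add: Var_neq_0)
  ultimately show ?thesis using t that by blast
qed

lemma mpoly3_decompose: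
  fixes F :: "(3, 'r::comm_ring_1) mpoly"
  obtains c u v w where "F = Cst c + Var 1 * u + Var 2 * v + Var 3 * w"
proof -
  have sub: "subst (\<lambda>_. 0) F = Cst (eval (\<lambda>_. 0) F)"
    by (induction F rule: mpoly_induct)
      (simp_all add: subst.eval_simps eval.eval_simps Cst_add Cst_mult)
  have "Var i - 0 \<in> ideal_gen {Var 1, Var 2, Var 3 :: (3, 'r) mpoly}" for i
    using exhaust_3[of i] by (auto intro: ideal.span_base)
  then have "F - subst (\<lambda>_. 0) F \<in> ideal_gen {Var 1, Var 2, Var 3}"
    by (rule subst_congruent_mod)
  then have "F - Cst (eval (\<lambda>_. 0) F) \<in> ideal_gen {Var 1, Var 2, Var 3}" by (simp only: sub)
  then obtain u v w where "F - Cst (eval (\<lambda>_. 0) F) = u * Var 1 + v * Var 2 + w * Var 3"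
    unfolding ideal_gen_3 by blast
  then have "F = Cst (eval (\<lambda>_. 0) F) + Var 1 * u + Var 2 * v + Var 3 * w"
    by (simp add: algebra_simps)
  then show ?thesis by (rule that)
qed

text \<open>
  Membership in the \<open>N\<close>-th power of the ideal of the variables.
\<close>

definition order_ge :: "nat \<Rightarrow> ('i, 'r::zero) mpoly \<Rightarrow> bool" where
  "order_ge N P \<longleftrightarrow> (\<forall>m\<in>Poly_Mapping.keys P. N \<le> mon_degree m)"

lemma order_ge_add: "order_ge N P \<Longrightarrow> order_ge N Q \<Longrightarrow> order_ge N (P + Q)"
  using keys_add[of P Q] by (auto simp: order_ge_def)

lemma order_ge_Var_mult:
  fixes P :: "('i, 'r::comm_ring_1) mpoly"
  assumes "order_ge N P" shows "order_ge (Suc N) (Var i * P)"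
  using assms keys_mult[of "Var i" P] by (fastforce simp: order_ge_def mon_degree_add)

lemma order_ge_all_0:
  assumes "\<And>N. order_ge N P" shows "P = 0"
proof (rule ccontr)
  assume "P \<noteq> 0"
  then obtain m where m: "m \<in> Poly_Mapping.keys P" by (metis keys_eq_empty all_not_in_conv)
  show False using assms[of "Suc (mon_degree m)"] m by (auto simp: order_ge_def)
qed

section \<open>Syzygies, linear forms and quadratic forms\<close>

text \<open>
  Elements of a free module with basis \<open>J\<close> are functions on the index type. Only the values on \<open>J\<close>
  matter for \<open>dot\<close> and \<open>lform\<close> below; syzygies are required to vanish outside of \<open>J\<close>, so that they form
  a submodule of the free module.
\<close>

definition vscale :: "'r::comm_ring_1 \<Rightarrow> ('j \<Rightarrow> 'r) \<Rightarrow> ('j \<Rightarrow> 'r)" where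
  "vscale r g = (\<lambda>j. r * g j)"

lemma vscale_apply [simp]: "vscale r g j = r * g j"
  by (simp add: vscale_def)

interpretation vect: module "vscale :: 'r::comm_ring_1 \<Rightarrow> ('j \<Rightarrow> 'r) \<Rightarrow> _"
  by unfold_locales (auto simp: fun_eq_iff algebra_simps)

lemma representation_expand:
  assumes "vect.independent B" "s \<in> vect.span B" "finite K" "{b. vect.representation B s b \<noteq> 0} \<subseteq> K"
  shows "s = (\<Sum>b\<in>K. vscale (vect.representation B s b) b)"
proof -
  have "s = (\<Sum>b | vect.representation B s b \<noteq> 0. vscale (vect.representation B s b) b)"
    using vect.sum_nonzero_representation_eq[OF assms(1,2)] by simp
  also have "\<dots> = (\<Sum>b\<in>K. vscale (vect.representation B s b) b)"
    using assms(3,4) by (intro sum.mono_neutral_left) auto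
  finally show ?thesis .
qed

lemma sum_fun_apply: "(\<Sum>x\<in>A. f x) j = (\<Sum>x\<in>A. f x j)"
  by (induction A rule: infinite_finite_induct) auto

interpretation forms: module "\<lambda>(r :: 'r::comm_ring_1) (P :: ('j, 'r) mpoly). Cst r * P"
  by unfold_locales (auto simp: Cst_add Cst_mult algebra_simps)

declare vect.scale_scale [simp del] forms.scale_scale [simp del]

definition dot :: "'j set \<Rightarrow> ('j \<Rightarrow> 'r::comm_ring_1) \<Rightarrow> ('j \<Rightarrow> 'r) \<Rightarrow> 'r" where
  "dot J a g = (\<Sum>j\<in>J. g j * a j)"

lemma dot_0 [simp]: "dot J a 0 = 0"
  and dot_add: "dot J a (g + g') = dot J a g + dot J a g'"
  and dot_scale: "dot J a (vscale r g) = r * dot J a g"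
  and dot_diff: "dot J a (g - g') = dot J a g - dot J a g'"
  and dot_add_left: "dot J (a + a') g = dot J a g + dot J a' g"
  by (simp_all add: dot_def algebra_simps sum.distrib sum_subtractf sum_distrib_left)

lemma dot_sum: "dot J a (\<Sum>x\<in>A. g x) = (\<Sum>x\<in>A. dot J a (g x))"
  unfolding dot_def sum_fun_apply sum_distrib_right by (rule sum.swap)

definition unit :: "'j \<Rightarrow> 'j \<Rightarrow> 'r::comm_ring_1" where
  "unit i = (\<lambda>j. if j = i then 1 else 0)"

lemma dot_unit_left: "finite J \<Longrightarrow> j \<in> J \<Longrightarrow> dot J (unit j) g = g j"
  by (simp add: dot_def unit_def if_distrib[of "(*) _"] sum.delta cong: if_cong)

lemma dot_unit: "finite J \<Longrightarrow> j \<in> J \<Longrightarrow> dot J a (unit j) = a j"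
  by (simp add: dot_def unit_def if_distrib[of "\<lambda>x. x * _"] sum.delta cong: if_cong)

definition syz :: "'j set \<Rightarrow> ('j \<Rightarrow> 'r::comm_ring_1) \<Rightarrow> ('j \<Rightarrow> 'r) set" where
  "syz J a = {g. (\<forall>j. j \<notin> J \<longrightarrow> g j = 0) \<and> dot J a g = 0}"

lemma syz_subspace: "vect.subspace (syz J a)"
  by (rule vect.subspaceI) (auto simp: syz_def dot_add dot_scale)

lemma cut_in_syz:
  assumes "dot J a g = 0" shows "(\<lambda>j. if j \<in> J then g j else 0) \<in> syz J a"
  using assms by (simp add: syz_def dot_def)

text \<open>
  The ideal generated by the \<open>a j\<close>.
\<close>

definition combinations :: "'j set \<Rightarrow> ('j \<Rightarrow> 'r::comm_ring_1) \<Rightarrow> 'r set" where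
  "combinations J a = range (dot J a)"

lemma combinations_subspace: "ideal.subspace (combinations J a)"
proof (rule ideal.subspaceI)
  show "0 \<in> combinations J a" unfolding combinations_def by (rule range_eqI[of _ _ 0]) simp
qed (auto simp: combinations_def simp flip: dot_add dot_scale)

lemma combinations_base: "finite J \<Longrightarrow> j \<in> J \<Longrightarrow> a j \<in> combinations J a"
  unfolding combinations_def by (metis dot_unit rangeI)

definition lform :: "'j set \<Rightarrow> ('j \<Rightarrow> 'r::comm_ring_1) \<Rightarrow> ('j, 'r) mpoly" where
  "lform J g = (\<Sum>j\<in>J. Cst (g j) * Var j)"

lemma lform_0 [simp]: "lform J 0 = 0"
  and lform_add: "lform J (g + g') = lform J g + lform J g'"
  and lform_scale: "lform J (vscale r g) = Cst r * lform J g"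
  and lform_diff: "lform J (g - g') = lform J g - lform J g'"
  by (simp_all add: lform_def Cst_add Cst_mult Cst_diff algebra_simps sum.distrib
      sum_subtractf sum_distrib_left)

lemma lform_sum: "lform J (\<Sum>x\<in>A. g x) = (\<Sum>x\<in>A. lform J (g x))"
  unfolding lform_def sum_fun_apply Cst_sum sum_distrib_right by (rule sum.swap)

lemma lform_cut: "lform J (\<lambda>j. if j \<in> J then g j else 0) = lform J g"
  by (simp add: lform_def)

lemma lform_unit: "finite J \<Longrightarrow> j \<in> J \<Longrightarrow> lform J (unit j) = Var j"
  by (simp add: lform_def unit_def if_distrib[of Cst] if_distrib[of "\<lambda>x. x * _"] sum.delta cong: if_cong)

lemma eval_lform: "eval t (lform J g) = dot J t g"
  by (simp add: lform_def eval.eval_simps dot_def)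

text \<open>
  The image of \<open>F \<otimes> G\<close> in the symmetric square of \<open>G\<close>, where \<open>G\<close> is the free module and \<open>F\<close> the module
  of syzygies. The quotient of the quadratic forms by it is the symmetric square of the ideal.
\<close>

definition syz_products :: "'j set \<Rightarrow> ('j \<Rightarrow> 'r::comm_ring_1) \<Rightarrow> ('j, 'r) mpoly set" where
  "syz_products J a = forms.span {lform J g * lform J s | g s. s \<in> syz J a}"

lemma syz_products_subspace: "forms.subspace (syz_products J a)"
  by (simp add: syz_products_def forms.subspace_span)

lemma syz_productsI:
  assumes "dot J a s = 0" shows "lform J g * lform J s \<in> syz_products J a"
proof -
  have "lform J g * lform J (\<lambda>j. if j \<in> J then s j else 0) \<in> syz_products J a"
    unfolding syz_products_def using cut_in_syz[OF assms] by (intro forms.span_base) blast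
  then show ?thesis by (simp only: lform_cut)
qed

lemma eval_syz_products: "P \<in> syz_products J a \<Longrightarrow> eval a P = 0"
  unfolding syz_products_def
proof (induction rule: forms.span_induct_alt)
  case (step c x y)
  then show ?case by (auto simp: eval.eval_simps eval_lform syz_def)
qed (simp add: eval.eval_simps)

definition quadratics :: "'j set \<Rightarrow> ('j, 'r::comm_ring_1) mpoly set" where
  "quadratics J = forms.span {Var i * Var k | i k. i \<in> J \<and> k \<in> J}"

lemma quadratics_subspace: "forms.subspace (quadratics J)"
  by (simp add: quadratics_def forms.subspace_span)

lemma lform_mult_lform_in_quadratics: "lform J g * lform J g' \<in> quadratics J"
proof -
  have "lform J g * lform J g' = (\<Sum>i\<in>J. \<Sum>k\<in>J. Cst (g i * g' k) * (Var i * Var k))"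
    by (simp add: lform_def sum_product Cst_mult mult_ac)
  also have "\<dots> \<in> quadratics J"
    unfolding quadratics_def
    by (intro forms.span_sum forms.span_scale forms.span_base) blast
  finally show ?thesis .
qed

section \<open>Quadratic relations at a complete intersection\<close>

text \<open>
  A quadratic relation between two elements \<open>l, l'\<close> that are regular modulo each other comes from the
  linear relation \<open>l' * l - l * l' = 0\<close>.
\<close>

lemma complete_intersection_quadric:
  fixes l l' :: "'r::idom"
  assumes l: "l \<noteq> 0" "l' \<noteq> 0"
    and reg: "\<And>x. l dvd l' * x \<Longrightarrow> l dvd x" "\<And>x. l' dvd l * x \<Longrightarrow> l' dvd x"
    and 0: "A * l\<^sup>2 + B * (l * l') + C * l'\<^sup>2 = 0"
  obtains A' C' where "A = l' * A'" "C = l * C'" "B = - (A' * l) - C' * l'"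
proof -
  have "l * (l * A) = l' * (- (B * l) - C * l')"
    using 0 by (simp add: power2_eq_square algebra_simps eq_neg_iff_add_eq_0)
  then have "l' dvd A" using reg(2) by (metis dvd_triv_left)
  then obtain A' where A': "A = l' * A'" by (elim dvdE)
  have "l' * (A' * l\<^sup>2 + B * l + C * l') = 0"
    using 0 by (simp add: A' power2_eq_square algebra_simps)
  then have 1: "A' * l\<^sup>2 + B * l + C * l' = 0" using l by simp
  then have "l' * C = l * (- (A' * l) - B)"
    by (simp add: power2_eq_square algebra_simps eq_neg_iff_add_eq_0)
  then have "l dvd C" using reg(1) by (metis dvd_triv_left)
  then obtain C' where C': "C = l * C'" by (elim dvdE)
  have "l * (A' * l + B + C' * l') = 0"
    using 1 by (simp add: C' power2_eq_square algebra_simps)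
  then have "A' * l + B + C' * l' = 0" using l(1) by simp
  then have "B = - (A' * l) - C' * l'" by (simp add: algebra_simps eq_neg_iff_add_eq_0)
  with A' C' show ?thesis by (rule that)
qed

text \<open>
  After multiplication by \<open>g\<close>, the generators \<open>a j\<close> are combinations of the two elements \<open>g * l\<close> and
  \<open>g * l'\<close> of the ideal. So modulo linear relations a quadratic form in the generators, times \<open>g\<^sup>2\<close>,
  is a quadratic form in two variables \<open>x, y\<close> standing for these elements, and
  \<open>complete_intersection_quadric\<close> applies.
\<close>

theorem quadric_relation_local:
  fixes a :: "'j \<Rightarrow> 'r::idom"
  assumes J: "finite J"
    and l: "l \<noteq> 0" "l' \<noteq> 0"
    and reg: "\<And>x. l dvd l' * x \<Longrightarrow> l dvd x" "\<And>x. l' dvd l * x \<Longrightarrow> l' dvd x"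
    and a: "\<And>j. j \<in> J \<Longrightarrow> \<exists>u v. a j = u * l + v * l'"
    and g: "g \<noteq> 0" "g * l \<in> combinations J a" "g * l' \<in> combinations J a"
    and w: "w \<in> quadratics J" "eval a w = 0"
  shows "Cst (g\<^sup>2) * w \<in> syz_products J a"
proof -
  note N = syz_products_subspace[of J a]
  obtain \<alpha> \<beta> where \<alpha>\<beta>: "g * l = dot J a \<alpha>" "g * l' = dot J a \<beta>"
    using g(2,3) by (auto simp: combinations_def)
  obtain u v where uv: "\<And>j. j \<in> J \<Longrightarrow> a j = u j * l + v j * l'" using a by metis
  define x where "x = lform J \<alpha>"
  define y where "y = lform J \<beta>"
  define M where "M j = Cst (u j) * x + Cst (v j) * y" for j
  \<comment> \<open>The linear relation that expresses \<open>g * a j\<close> by \<open>g * l\<close> and \<open>g * l'\<close>.\<close>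
  define E where "E j = vscale g (unit j) - vscale (u j) \<alpha> - vscale (v j) \<beta>" for j
  have E: "dot J a (E j) = 0" if "j \<in> J" for j
    unfolding E_def dot_diff dot_scale dot_unit[OF J that] \<alpha>\<beta>[symmetric]
    using uv[OF that] by (simp add: algebra_simps)
  have L_E: "lform J (E j) = Cst g * Var j - M j" if "j \<in> J" for j
    unfolding E_def lform_diff lform_scale lform_unit[OF J that] M_def x_def y_def by simp
  have M_lform: "M j = lform J (vscale (u j) \<alpha> + vscale (v j) \<beta>)" for j
    unfolding M_def x_def y_def lform_add lform_scale ..
  have "\<exists>A B C. Cst (g\<^sup>2) * w - (Cst A * x\<^sup>2 + Cst B * (x * y) + Cst C * y\<^sup>2) \<in> syz_products J a"
    using w(1) unfolding quadratics_def
  proof (induction rule: forms.span_induct_alt)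
    case base
    have "Cst (g\<^sup>2) * 0 - (Cst 0 * x\<^sup>2 + Cst 0 * (x * y) + Cst 0 * y\<^sup>2) \<in> syz_products J a"
      using forms.subspace_0[OF N] by simp
    then show ?case by blast
  next
    case (step c p q)
    then obtain i k where p: "p = Var i * Var k" and ik: "i \<in> J" "k \<in> J" by blast
    obtain A B C where IH: "Cst (g\<^sup>2) * q - (Cst A * x\<^sup>2 + Cst B * (x * y) + Cst C * y\<^sup>2) \<in> syz_products J a"
      using step by blast
    have 1: "lform J (vscale g (unit i)) * lform J (E k) \<in> syz_products J a"
      "M k * lform J (E i) \<in> syz_products J a"
      unfolding M_lform using E ik by (auto intro: syz_productsI)
    have "Cst (g\<^sup>2) * p - (Cst (u i * u k) * x\<^sup>2 + Cst (u i * v k + v i * u k) * (x * y)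
          + Cst (v i * v k) * y\<^sup>2)
        = lform J (vscale g (unit i)) * lform J (E k) + M k * lform J (E i)"
      unfolding L_E[OF ik(1)] L_E[OF ik(2)] lform_scale lform_unit[OF J ik(1)] M_def p
      by (simp add: Cst_mult Cst_add power2_eq_square algebra_simps)
    also have "\<dots> \<in> syz_products J a"
      using 1 by (rule forms.subspace_add[OF N])
    finally have D: "Cst (g\<^sup>2) * p - (Cst (u i * u k) * x\<^sup>2 + Cst (u i * v k + v i * u k) * (x * y)
          + Cst (v i * v k) * y\<^sup>2) \<in> syz_products J a" .
    have "Cst c * (Cst (g\<^sup>2) * p - (Cst (u i * u k) * x\<^sup>2 + Cst (u i * v k + v i * u k) * (x * y)
          + Cst (v i * v k) * y\<^sup>2))
        + (Cst (g\<^sup>2) * q - (Cst A * x\<^sup>2 + Cst B * (x * y) + Cst C * y\<^sup>2)) \<in> syz_products J a"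
      by (intro forms.subspace_add[OF N] forms.subspace_scale[OF N] D IH)
    also have "Cst c * (Cst (g\<^sup>2) * p - (Cst (u i * u k) * x\<^sup>2 + Cst (u i * v k + v i * u k) * (x * y)
          + Cst (v i * v k) * y\<^sup>2))
        + (Cst (g\<^sup>2) * q - (Cst A * x\<^sup>2 + Cst B * (x * y) + Cst C * y\<^sup>2))
        = Cst (g\<^sup>2) * (Cst c * p + q) - (Cst (c * (u i * u k) + A) * x\<^sup>2
          + Cst (c * (u i * v k + v i * u k) + B) * (x * y) + Cst (c * (v i * v k) + C) * y\<^sup>2)"
      by (simp add: Cst_mult Cst_add algebra_simps)
    finally show ?case by blast
  qed
  then obtain A B C where *: "Cst (g\<^sup>2) * w - (Cst A * x\<^sup>2 + Cst B * (x * y) + Cst C * y\<^sup>2) \<in> syz_products J a"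
    by blast
  have xy: "eval a x = g * l" "eval a y = g * l'"
    by (simp_all add: x_def y_def eval_lform \<alpha>\<beta>)
  have "- (A * (g * l)\<^sup>2 + B * (g * l * (g * l')) + C * (g * l')\<^sup>2) = 0"
    using eval_syz_products[OF *] by (simp add: eval.eval_simps power2_eq_square w(2) xy)
  then have "g\<^sup>2 * (A * l\<^sup>2 + B * (l * l') + C * l'\<^sup>2) = 0"
    by (simp add: power2_eq_square algebra_simps add_eq_0_iff)
  then have "A * l\<^sup>2 + B * (l * l') + C * l'\<^sup>2 = 0" using g(1) by simp
  then obtain A' C' where AC: "A = l' * A'" "C = l * C'" "B = - (A' * l) - C' * l'"
    using complete_intersection_quadric[OF l reg] by blast
  have syzygy: "dot J a (vscale l' \<alpha> - vscale l \<beta>) = 0"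
    unfolding dot_diff dot_scale \<alpha>\<beta>[symmetric] by (simp add: algebra_simps)
  have "Cst A * x\<^sup>2 + Cst B * (x * y) + Cst C * y\<^sup>2
      = lform J (vscale A' \<alpha> - vscale C' \<beta>) * lform J (vscale l' \<alpha> - vscale l \<beta>)"
    unfolding lform_diff lform_scale AC x_def[symmetric] y_def[symmetric]
      Cst_mult Cst_diff Cst_uminus power2_eq_square
    by (simp add: algebra_simps)
  then have "Cst A * x\<^sup>2 + Cst B * (x * y) + Cst C * y\<^sup>2 \<in> syz_products J a"
    using syz_productsI[OF syzygy] by simp
  from forms.subspace_add[OF N * this] show ?thesis by simp
qed

section \<open>Change of generators\<close>

lemma subst_lform:
  "subst (\<lambda>j. lform J' (Q j)) (lform J g) = lform J' (\<Sum>j\<in>J. vscale (g j) (Q j))"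
  unfolding lform_sum lform_scale by (simp add: lform_def[of J] subst.eval_simps)

text \<open>
  A quadratic relation between the \<open>f i\<close> is rewritten as one between the \<open>a j\<close>, where it comes from
  linear relations, and is then rewritten back. The round trip changes a variable only by a linear
  relation.
\<close>

lemma quadric_relations_change_generators:
  fixes a :: "'j \<Rightarrow> 'r::comm_ring_1" and f :: "'i \<Rightarrow> 'r"
  assumes J: "finite J" "finite J'"
    and fa: "\<And>i. i \<in> J' \<Longrightarrow> f i \<in> combinations J a" and af: "\<And>j. j \<in> J \<Longrightarrow> a j \<in> combinations J' f"
    and H: "\<And>w. w \<in> quadratics J \<Longrightarrow> eval a w = 0 \<Longrightarrow> w \<in> syz_products J a"
    and w: "w \<in> quadratics J'" "eval f w = 0"
  shows "w \<in> syz_products J' f"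
proof -
  note N = syz_products_subspace[of J' f]
  have "\<forall>i\<in>J'. \<exists>p. f i = dot J a p" using fa by (auto simp: combinations_def)
  from bchoice[OF this] obtain P where P: "\<And>i. i \<in> J' \<Longrightarrow> f i = dot J a (P i)" by blast
  have "\<forall>j\<in>J. \<exists>q. a j = dot J' f q" using af by (auto simp: combinations_def)
  from bchoice[OF this] obtain Q where Q: "\<And>j. j \<in> J \<Longrightarrow> a j = dot J' f (Q j)" by blast
  define S where "S = subst (\<lambda>i. lform J (P i))"
  define T where "T = subst (\<lambda>j. lform J' (Q j))"
  define R where "R i = (\<Sum>j\<in>J. vscale (P i j) (Q j))" for i
  have dot_comp: "dot J' f (\<Sum>j\<in>J. vscale (g j) (Q j)) = dot J a g" for g
    unfolding dot_sum dot_scale by (simp add: dot_def[of J] Q)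
  have TS: "T (S (Var i)) = lform J' (R i)" for i
    unfolding S_def T_def R_def subst.eval_Var subst_lform ..
  have R: "dot J' f (unit i - R i) = 0" if "i \<in> J'" for i
    unfolding dot_diff R_def dot_comp dot_unit[OF J(2) that] using P[OF that] by simp
  have "S w \<in> quadratics J \<and> eval a (S w) = eval f w \<and> w - T (S w) \<in> syz_products J' f"
    using w(1) unfolding quadratics_def[of J']
  proof (induction rule: forms.span_induct_alt)
    case base
    show ?case
      using forms.subspace_0[OF quadratics_subspace] forms.subspace_0[OF N]
      by (simp add: S_def T_def subst.eval_simps eval.eval_simps)
  next
    case (step c p q)
    then obtain i k where p: "p = Var i * Var k" and ik: "i \<in> J'" "k \<in> J'" by blast
    have Sp: "S p = lform J (P i) * lform J (P k)" by (simp add: p S_def subst.eval_simps)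
    have 1: "S (Cst c * p + q) = Cst c * S p + S q" "T (Cst c * S p + S q) = Cst c * T (S p) + T (S q)"
      unfolding S_def T_def subst.eval_simps by (rule refl)+
    have "p - T (S p) = lform J' (unit i) * lform J' (unit k - R k) + lform J' (R k) * lform J' (unit i - R i)"
      unfolding lform_diff lform_unit[OF J(2) ik(1)] lform_unit[OF J(2) ik(2)] TS[symmetric] p
      by (simp add: S_def T_def subst.eval_simps algebra_simps)
    also have "\<dots> \<in> syz_products J' f"
      using R ik by (intro forms.subspace_add[OF N] syz_productsI)
    finally have "p - T (S p) \<in> syz_products J' f" .
    then have "Cst c * (p - T (S p)) + (q - T (S q)) \<in> syz_products J' f"
      using step by (intro forms.subspace_add[OF N] forms.subspace_scale[OF N]) auto
    moreover have "Cst c * (p - T (S p)) + (q - T (S q)) = Cst c * p + q - T (S (Cst c * p + q))"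
      unfolding 1 by (simp add: algebra_simps)
    moreover have "S (Cst c * p + q) \<in> quadratics J"
      unfolding 1(1) Sp using step lform_mult_lform_in_quadratics
      by (intro forms.subspace_add[OF quadratics_subspace] forms.subspace_scale[OF quadratics_subspace]) auto
    moreover have "eval a (S (Cst c * p + q)) = eval f (Cst c * p + q)"
      unfolding 1(1) Sp using step P ik by (simp add: eval.eval_simps eval_lform p)
    ultimately show ?case by simp
  qed
  then have Sw: "S w \<in> syz_products J a" and w': "w - T (S w) \<in> syz_products J' f"
    using H[of "S w"] w(2) by auto
  have "T (S w) \<in> syz_products J' f"
    using Sw unfolding syz_products_def[of J]
  proof (induction rule: forms.span_induct_alt)
    case base
    show ?case using forms.subspace_0[OF N] by (simp add: T_def subst.eval_simps)
  next
    case (step c p q)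
    then obtain g s where p: "p = lform J g * lform J s" and s: "s \<in> syz J a" by blast
    have "T p \<in> syz_products J' f"
      unfolding p T_def subst.eval_mult subst_lform using s
      by (intro syz_productsI) (simp add: dot_comp syz_def)
    moreover have "T (Cst c * p + q) = Cst c * T p + T q" by (simp add: T_def subst.eval_simps)
    ultimately show ?case
      using step forms.subspace_add[OF N] forms.subspace_scale[OF N] by metis
  qed
  from forms.subspace_add[OF N w' this] show ?thesis by simp
qed

section \<open>Torsion-freeness of the second symmetric power\<close>

text \<open>
  \<open>F \<otimes> G\<close> is the direct sum of copies of \<open>G\<close> indexed by a basis \<open>B\<close> of \<open>F\<close>.
\<close>

lemma syz_products_basis_expansion:
  fixes a :: "'j \<Rightarrow> 'r::comm_ring_1"
  assumes B: "vect.independent B" "vect.span B = syz J a" and P: "P \<in> syz_products J a"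
  obtains K g where "finite K" "K \<subseteq> B" "P = (\<Sum>b\<in>K. lform J (g b) * lform J b)"
proof -
  let ?ex = "\<lambda>K g P. finite K \<and> K \<subseteq> B \<and> (\<forall>b. b \<notin> K \<longrightarrow> g b = 0) \<and>
    P = (\<Sum>b\<in>K. lform J (g b) * lform J b)"
  have "\<exists>K g. ?ex K g P"
    using P unfolding syz_products_def
  proof (induction rule: forms.span_induct_alt)
    case base
    have "?ex {} 0 0" by simp
    then show ?case by blast
  next
    case (step c x y)
    then obtain g s where x: "x = lform J g * lform J s" and s: "s \<in> syz J a" by auto
    let ?r = "vect.representation B s"
    from step obtain K G where KG: "?ex K G y" by blast
    define K' where "K' = K \<union> {b. ?r b \<noteq> 0}"
    have K': "finite K'" "K' \<subseteq> B"
      using KG vect.finite_representation[of B s] vect.representation_ne_zero[of B s]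
      by (auto simp: K'_def)
    have "s = (\<Sum>b\<in>K'. vscale (?r b) b)"
      using B s K' by (intro representation_expand) (auto simp: K'_def)
    from arg_cong[OF this, of "lform J"]
    have "lform J s = (\<Sum>b\<in>K'. Cst (?r b) * lform J b)"
      unfolding lform_sum lform_scale .
    then have 1: "Cst c * x = (\<Sum>b\<in>K'. lform J (vscale (c * ?r b) g) * lform J b)"
      by (simp add: x sum_distrib_left lform_scale Cst_mult mult_ac)
    have "y = (\<Sum>b\<in>K. lform J (G b) * lform J b)" using KG by blast
    also have "\<dots> = (\<Sum>b\<in>K'. lform J (G b) * lform J b)"
      using KG K' by (intro sum.mono_neutral_left) (auto simp: K'_def)
    finally have 2: "y = (\<Sum>b\<in>K'. lform J (G b) * lform J b)" .
    have "Cst c * x + y = (\<Sum>b\<in>K'. lform J (vscale (c * ?r b) g + G b) * lform J b)"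
      unfolding 1 2 lform_add distrib_right sum.distrib ..
    moreover have "vscale (c * ?r b) g + G b = 0" if "b \<notin> K'" for b
    proof -
      have "?r b = 0" "G b = 0" using that KG by (auto simp: K'_def)
      then show ?thesis by simp
    qed
    ultimately show ?case
      by (intro exI[of _ K'] exI[of _ "\<lambda>b. vscale (c * ?r b) g + G b"] conjI allI impI K')
  qed
  then show ?thesis using that by blast
qed

text \<open>
  The matrix \<open>e\<close> is alternating modulo \<open>h\<close>, so its quadratic form is divisible by \<open>h\<close>; the point is
  that the quotient is again a sum of products of syzygies.
\<close>

lemma symmetric_sum_divisible:
  fixes h :: "'r::comm_ring_1"
  assumes "finite K" "K \<subseteq> syz J a"
    and diag: "\<And>b. b \<in> K \<Longrightarrow> h dvd e b b"
    and off: "\<And>b c. b \<in> K \<Longrightarrow> c \<in> K \<Longrightarrow> b \<noteq> c \<Longrightarrow> h dvd e b c + e c b"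
  shows "\<exists>P\<in>syz_products J a. (\<Sum>b\<in>K. \<Sum>c\<in>K. Cst (e b c) * (lform J b * lform J c)) = Cst h * P"
  using assms
proof (induction K rule: finite_induct)
  case empty
  show ?case by (auto intro!: bexI[of _ 0] forms.subspace_0 syz_products_subspace)
next
  case (insert x K)
  let ?L = "lform J"
  obtain P where P: "P \<in> syz_products J a"
    "(\<Sum>b\<in>K. \<Sum>c\<in>K. Cst (e b c) * (?L b * ?L c)) = Cst h * P"
    using insert.IH insert.prems by blast
  obtain d where d: "e x x = h * d" using insert.prems(2)[of x] by auto
  have "\<forall>c\<in>K. \<exists>r. e x c + e c x = h * r"
    using insert.prems(3)[of x] insert.hyps by (auto simp: dvd_def)
  then obtain r where r: "\<And>c. c \<in> K \<Longrightarrow> e x c + e c x = h * r c" by metis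
  have prod: "?L x * ?L c \<in> syz_products J a" if "c \<in> insert x K" for c
    using that insert.prems(1) by (intro syz_productsI) (auto simp: syz_def)
  let ?Q = "P + Cst d * (?L x * ?L x) + (\<Sum>c\<in>K. Cst (r c) * (?L x * ?L c))"
  have "?Q \<in> syz_products J a"
    by (intro forms.subspace_add[OF syz_products_subspace] forms.subspace_sum[OF syz_products_subspace]
        forms.subspace_scale[OF syz_products_subspace] P prod) auto
  moreover have "(\<Sum>c\<in>K. Cst (e x c) * (?L x * ?L c)) + (\<Sum>c\<in>K. Cst (e c x) * (?L c * ?L x))
      = Cst h * (\<Sum>c\<in>K. Cst (r c) * (?L x * ?L c))"
  proof -
    have "(\<Sum>c\<in>K. Cst (e x c) * (?L x * ?L c)) + (\<Sum>c\<in>K. Cst (e c x) * (?L c * ?L x))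
        = (\<Sum>c\<in>K. Cst (e x c + e c x) * (?L x * ?L c))"
      by (simp add: Cst_add sum.distrib algebra_simps)
    also have "\<dots> = (\<Sum>c\<in>K. Cst h * (Cst (r c) * (?L x * ?L c)))"
      by (intro sum.cong) (simp_all add: r Cst_mult mult.assoc)
    finally show ?thesis by (simp add: sum_distrib_left)
  qed
  then have "(\<Sum>b\<in>insert x K. \<Sum>c\<in>insert x K. Cst (e b c) * (?L b * ?L c)) = Cst h * ?Q"
    using insert.hyps P(2) by (simp add: sum.distrib d Cst_mult algebra_simps)
  ultimately show ?case by blast
qed

lemma sum_mult_unit: "finite K \<Longrightarrow> b \<in> K \<Longrightarrow> (\<Sum>x\<in>K. f x * unit b x) = (f b :: 'r::comm_ring_1)"
  by (simp add: unit_def if_distrib[of "(*) _"] sum.delta cong: if_cong)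

text \<open>
  Write \<open>h w = \<Sum> g b \<cdot> b\<close> over the basis elements \<open>b\<close> of \<open>F\<close>. It suffices to treat
  \<open>w\<close> up to elements of \<open>syz_products\<close>.

  First, polarising at \<open>a\<close> removes the factors \<open>b\<close>, which vanish there, and shows that
  \<open>\<Sum> g b (a) b = h v\<close> for some \<open>v\<close>, which is a syzygy again. So \<open>g b (a)\<close> is \<open>h\<close> times a coordinate of
  \<open>v\<close>, and as \<open>h\<close> is regular modulo the ideal, this coordinate is \<open>\<tau> b (a)\<close> for some \<open>\<tau> b\<close>. Subtracting
  \<open>h \<tau> b\<close> from \<open>g b\<close> makes all \<open>g b\<close> syzygies.

  Secondly, \<open>h w\<close> is now \<open>\<Sum> e b c (b \<cdot> c)\<close>. For \<open>u\<close> in the ideal, \<open>u\<close> times a coordinate function of \<open>F\<close>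
  extends to a linear function on \<open>G\<close>, since \<open>u g\<close> differs from a syzygy by a multiple of a fixed
  vector. Evaluating \<open>h w\<close> at sums of such functions shows that \<open>h\<close> divides \<open>u\<^sup>2\<close> times the values of
  the quadratic form \<open>e\<close>, and the grade hypothesis removes \<open>u\<^sup>2\<close>.

  Thirdly, \<open>e\<close> is therefore alternating modulo \<open>h\<close>, also in characteristic two, and \<open>h\<close> can be
  cancelled.
\<close>

theorem syz_products_torsion_free:
  fixes a :: "'j \<Rightarrow> 'r::idom"
  assumes J: "finite J"
    and B: "vect.independent B" "vect.span B = syz J a"
    and h: "h \<noteq> 0" and nzd: "\<And>t. h * t \<in> combinations J a \<Longrightarrow> t \<in> combinations J a"
    and grade: "\<And>r. (\<And>u. u \<in> combinations J a \<Longrightarrow> h dvd u\<^sup>2 * r) \<Longrightarrow> h dvd r"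
    and hw: "Cst h * w \<in> syz_products J a"
  shows "w \<in> syz_products J a"
proof -
  let ?L = "lform J" and ?\<psi> = "vect.representation B"
  note N_sub = syz_products_subspace[of J a]
  have B_syz: "B \<subseteq> syz J a" using B vect.span_superset by blast
  obtain K g where K: "finite K" "K \<subseteq> B" and hw_eq: "Cst h * w = (\<Sum>b\<in>K. ?L (g b) * ?L b)"
    using syz_products_basis_expansion[OF B hw] .
  have K_syz: "b \<in> K \<Longrightarrow> b \<in> syz J a" for b using K B_syz by blast
  have ha: "h * eval t w = (\<Sum>b\<in>K. dot J t (g b) * dot J t b)" for t
  proof -
    have "eval t (Cst h * w) = (\<Sum>b\<in>K. dot J t (g b) * dot J t b)"
      unfolding hw_eq by (simp add: eval.eval_simps eval_lform)
    then show ?thesis by (simp add: eval.eval_simps)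
  qed
  \<comment> \<open>The polar form of \<open>w\<close> at \<open>a\<close> and the unit vectors.\<close>
  define v where "v j = (if j \<in> J then eval (a + unit j) w - eval a w - eval (unit j) w else 0)" for j
  have hv: "vscale h v = (\<Sum>b\<in>K. vscale (dot J a (g b)) b)"
  proof
    fix j
    show "vscale h v j = (\<Sum>b\<in>K. vscale (dot J a (g b)) b) j"
    proof (cases "j \<in> J")
      case True
      have "h * v j = (\<Sum>b\<in>K. dot J (a + unit j) (g b) * dot J (a + unit j) b
          - dot J a (g b) * dot J a b - dot J (unit j) (g b) * dot J (unit j) b)"
        using True by (simp add: v_def right_diff_distrib ha sum_subtractf)
      also have "\<dots> = (\<Sum>b\<in>K. dot J a (g b) * b j)"
        using J True K_syz
        by (intro sum.cong) (auto simp: dot_add_left dot_unit_left syz_def algebra_simps)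
      finally show ?thesis by (simp add: sum_fun_apply)
    next
      case False
      then have "(\<Sum>b\<in>K. dot J a (g b) * b j) = 0"
        using K_syz by (intro sum.neutral) (auto simp: syz_def)
      with False show ?thesis by (simp add: v_def sum_fun_apply)
    qed
  qed
  have "vscale h v \<in> syz J a"
    unfolding hv using K_syz
    by (intro vect.subspace_sum[OF syz_subspace] vect.subspace_scale[OF syz_subspace]) auto
  then have v: "v \<in> syz J a"
    using h by (auto simp: syz_def dot_scale)
  have repr_hv: "?\<psi> (vscale h v) b = h * ?\<psi> v b" for b
    using B v by (simp add: vect.representation_scale)
  have "?\<psi> (\<Sum>b\<in>K. vscale (dot J a (g b)) b) b = dot J a (g b)" if "b \<in> K" for b
  proof -
    have "?\<psi> (\<Sum>b\<in>K. vscale (dot J a (g b)) b) = (\<lambda>c. \<Sum>b\<in>K. ?\<psi> (vscale (dot J a (g b)) b) c)"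
      using K_syz B by (intro vect.representation_sum) (auto intro: vect.subspace_scale[OF syz_subspace])
    also have "\<dots> = (\<lambda>c. \<Sum>b\<in>K. dot J a (g b) * (if c = b then 1 else 0))"
      using K_syz B K by (intro ext sum.cong) (auto simp: vect.representation_scale vect.representation_basis)
    finally show ?thesis
      using K(1) that by (simp add: if_distrib[of "(*) _"] sum.delta' cong: if_cong)
  qed
  then have ga: "dot J a (g b) = h * ?\<psi> v b" if "b \<in> K" for b
    using repr_hv[of b] that by (simp add: hv)
  have "\<forall>b\<in>K. \<exists>\<tau>. ?\<psi> v b = dot J a \<tau>"
  proof
    fix b assume "b \<in> K"
    then have "h * ?\<psi> v b \<in> combinations J a" by (metis ga combinations_def rangeI)
    then show "\<exists>\<tau>. ?\<psi> v b = dot J a \<tau>" using nzd by (auto simp: combinations_def)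
  qed
  then obtain \<tau> where \<tau>: "\<And>b. b \<in> K \<Longrightarrow> ?\<psi> v b = dot J a (\<tau> b)" by metis
  define g' where "g' b = (if b \<in> K then \<lambda>j. if j \<in> J then (g b - vscale h (\<tau> b)) j else 0 else 0)" for b
  have g': "g' b \<in> syz J a" for b
  proof (cases "b \<in> K")
    case True
    then have "dot J a (g b - vscale h (\<tau> b)) = 0"
      by (simp add: dot_diff dot_scale ga \<tau>)
    from cut_in_syz[OF this] show ?thesis using True by (simp add: g'_def)
  qed (simp add: g'_def vect.subspace_0[OF syz_subspace])
  have L_g': "?L (g' b) = ?L (g b) - Cst h * ?L (\<tau> b)" if "b \<in> K" for b
    using that lform_cut[of J "g b - vscale h (\<tau> b)"] by (simp add: g'_def lform_diff lform_scale)
  define w' where "w' = w - (\<Sum>b\<in>K. ?L (\<tau> b) * ?L b)"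
  have "(\<Sum>b\<in>K. ?L (g' b) * ?L b) = (\<Sum>b\<in>K. ?L (g b) * ?L b - Cst h * (?L (\<tau> b) * ?L b))"
    by (intro sum.cong) (simp_all add: L_g' algebra_simps)
  then have hw': "Cst h * w' = (\<Sum>b\<in>K. ?L (g' b) * ?L b)"
    by (simp add: w'_def right_diff_distrib hw_eq sum_subtractf sum_distrib_left)
  define e where "e b c = ?\<psi> (g' b) c" for b c
  define K' where "K' = K \<union> (\<Union>b\<in>K. {c. e b c \<noteq> 0})"
  have K': "finite K'" "K \<subseteq> K'" "K' \<subseteq> B"
    using K vect.finite_representation[of B] vect.representation_ne_zero[of B]
    by (auto simp: K'_def e_def)
  have g'_expand: "g' b = (\<Sum>c\<in>K'. vscale (e b c) c)" if "b \<in> K" for b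
    unfolding e_def using B g' K' that
    by (intro representation_expand) (auto simp: K'_def e_def)
  have e_0: "e b c = 0" if "b \<notin> K" for b c
    using that by (simp add: e_def g'_def vect.representation_zero)
  have "(\<Sum>b\<in>K. ?L (g' b) * ?L b) = (\<Sum>b\<in>K. \<Sum>c\<in>K'. Cst (e b c) * (?L b * ?L c))"
  proof (intro sum.cong refl)
    fix b assume "b \<in> K"
    from arg_cong[OF g'_expand[OF this], of ?L]
    have "?L (g' b) = (\<Sum>c\<in>K'. Cst (e b c) * ?L c)"
      unfolding lform_sum lform_scale .
    then show "?L (g' b) * ?L b = (\<Sum>c\<in>K'. Cst (e b c) * (?L b * ?L c))"
      by (simp add: sum_distrib_right mult_ac sum_distrib_left)
  qed
  also have "\<dots> = (\<Sum>b\<in>K'. \<Sum>c\<in>K'. Cst (e b c) * (?L b * ?L c))"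
    using K' by (intro sum.mono_neutral_left) (auto simp: e_0)
  finally have hw'_e: "Cst h * w' = (\<Sum>b\<in>K'. \<Sum>c\<in>K'. Cst (e b c) * (?L b * ?L c))"
    using hw' by simp
  have quad: "h dvd (\<Sum>b\<in>K'. \<Sum>c\<in>K'. e b c * x b * x c)" for x
  proof (rule grade)
    fix u assume "u \<in> combinations J a"
    then obtain y where y: "u = dot J a y" by (auto simp: combinations_def)
    define \<kappa> where "\<kappa> s = (\<Sum>c\<in>K'. ?\<psi> s c * x c)" for s
    have \<kappa>_basis: "\<kappa> b = x b" if "b \<in> K'" for b
    proof -
      have "\<kappa> b = (\<Sum>c\<in>K'. x c * unit b c)"
        unfolding \<kappa>_def unit_def using that K' B vect.representation_basis[of B b]
        by (intro sum.cong) auto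
      then show ?thesis using that K' by (simp add: sum_mult_unit)
    qed
    \<comment> \<open>The \<open>j\<close>-th unit vector, multiplied by \<open>u\<close> and corrected to a syzygy by a multiple of \<open>y\<close>.\<close>
    define z where "z j = (\<lambda>i. if i \<in> J then (vscale u (unit j) - vscale (a j) y) i else 0)" for j
    have z: "z j \<in> syz J a" if "j \<in> J" for j
      unfolding z_def
    proof (rule cut_in_syz)
      show "dot J a (vscale u (unit j) - vscale (a j) y) = 0"
        unfolding dot_diff dot_scale dot_unit[OF J that] y by (simp add: mult.commute)
    qed
    have \<kappa>_z: "dot J (\<lambda>j. \<kappa> (z j)) s = u * \<kappa> s" if s: "s \<in> syz J a" for s
    proof -
      have s_z: "(\<Sum>j\<in>J. vscale (s j) (z j)) = vscale u s"
      proof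
        fix i
        show "(\<Sum>j\<in>J. vscale (s j) (z j)) i = vscale u s i"
        proof (cases "i \<in> J")
          case True
          have "(\<Sum>j\<in>J. vscale (s j) (z j)) i
              = u * (\<Sum>j\<in>J. s j * unit j i) - (\<Sum>j\<in>J. s j * a j) * y i"
            using True by (simp add: sum_fun_apply z_def right_diff_distrib sum_subtractf
                sum_distrib_left sum_distrib_right mult_ac)
          moreover have "(\<Sum>j\<in>J. s j * unit j i) = s i"
            using True J by (simp add: unit_def if_distrib[of "(*) _"] sum.delta cong: if_cong)
          ultimately show ?thesis using s by (simp add: syz_def dot_def)
        next
          case False
          then show ?thesis using s by (simp add: sum_fun_apply z_def syz_def)
        qed
      qed
      have "?\<psi> (\<Sum>j\<in>J. vscale (s j) (z j)) c = (\<Sum>j\<in>J. s j * ?\<psi> (z j) c)" for c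
        using z B
        by (subst vect.representation_sum) (auto simp: vect.representation_scale
            intro: vect.subspace_scale[OF syz_subspace])
      then have "\<kappa> (vscale u s) = (\<Sum>c\<in>K'. (\<Sum>j\<in>J. s j * ?\<psi> (z j) c) * x c)"
        unfolding \<kappa>_def s_z by simp
      also have "\<dots> = (\<Sum>c\<in>K'. \<Sum>j\<in>J. s j * (?\<psi> (z j) c * x c))"
        by (simp add: sum_distrib_right mult.assoc)
      also have "\<dots> = dot J (\<lambda>j. \<kappa> (z j)) s"
        by (subst sum.swap) (simp add: dot_def \<kappa>_def sum_distrib_left)
      finally show ?thesis
        using B s by (simp add: \<kappa>_def vect.representation_scale sum_distrib_left mult.assoc)
    qed
    let ?t = "\<lambda>j. \<kappa> (z j)"
    have "h * eval ?t w' = eval ?t (Cst h * w')" by (simp add: eval.eval_simps)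
    also have "\<dots> = (\<Sum>b\<in>K'. \<Sum>c\<in>K'. e b c * (dot J ?t b * dot J ?t c))"
      unfolding hw'_e by (simp add: eval.eval_simps eval_lform)
    also have "\<dots> = (\<Sum>b\<in>K'. \<Sum>c\<in>K'. u\<^sup>2 * (e b c * x b * x c))"
    proof (intro sum.cong refl)
      fix b c assume "b \<in> K'" "c \<in> K'"
      then have "dot J ?t b = u * x b" "dot J ?t c = u * x c"
        using \<kappa>_z \<kappa>_basis K' B_syz by (metis subsetD)+
      then show "e b c * (dot J ?t b * dot J ?t c) = u\<^sup>2 * (e b c * x b * x c)"
        by (simp add: power2_eq_square mult_ac)
    qed
    also have "\<dots> = u\<^sup>2 * (\<Sum>b\<in>K'. \<Sum>c\<in>K'. e b c * x b * x c)"
      by (simp add: sum_distrib_left)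
    finally show "h dvd u\<^sup>2 * (\<Sum>b\<in>K'. \<Sum>c\<in>K'. e b c * x b * x c)"
      by (metis dvd_triv_left)
  qed
  have bil: "(\<Sum>b\<in>K'. \<Sum>c\<in>K'. e b c * unit p b * unit q c) = e p q" if "p \<in> K'" "q \<in> K'" for p q
  proof -
    have "(\<Sum>b\<in>K'. \<Sum>c\<in>K'. e b c * unit p b * unit q c) = (\<Sum>b\<in>K'. e b q * unit p b)"
      using K'(1) that by (intro sum.cong) (simp_all add: sum_mult_unit)
    then show ?thesis using K'(1) that by (simp add: sum_mult_unit)
  qed
  have diag: "h dvd e b b" if "b \<in> K'" for b
    using quad[of "unit b"] bil[OF that that] by simp
  have off: "h dvd e b c + e c b" if bc: "b \<in> K'" "c \<in> K'" for b c
  proof -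
    \<comment> \<open>Polarisation of the quadratic form at two unit vectors.\<close>
    have "(\<Sum>p\<in>K'. \<Sum>q\<in>K'. e p q * (unit b + unit c) p * (unit b + unit c) q)
        = e b b + e b c + e c b + e c c"
      by (simp add: distrib_left distrib_right sum.distrib bil bc)
    then have "h dvd e b b + e b c + e c b + e c c" using quad[of "unit b + unit c"] by simp
    then have "h dvd (e b b + e b c + e c b + e c c) - e b b - e c c"
      using diag bc by (intro dvd_diff) auto
    then show ?thesis by simp
  qed
  have "\<exists>P\<in>syz_products J a. (\<Sum>b\<in>K'. \<Sum>c\<in>K'. Cst (e b c) * (?L b * ?L c)) = Cst h * P"
    using K' B_syz diag off by (intro symmetric_sum_divisible) auto
  then obtain P where P: "P \<in> syz_products J a" "Cst h * w' = Cst h * P"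
    using hw'_e by auto
  then have "w' \<in> syz_products J a" using Cst_mult_cancel[OF h] by metis
  moreover have "(\<Sum>b\<in>K. ?L (\<tau> b) * ?L b) \<in> syz_products J a"
    using K_syz by (intro forms.subspace_sum[OF N_sub] syz_productsI) (auto simp: syz_def)
  ultimately have "w' + (\<Sum>b\<in>K. ?L (\<tau> b) * ?L b) \<in> syz_products J a"
    by (rule forms.subspace_add[OF N_sub])
  then show ?thesis by (simp add: w'_def)
qed

section \<open>Freeness of the syzygy module\<close>

interpretation kvect: vector_space "\<lambda>(c :: 'k::field) (g :: 'j \<Rightarrow> (3, 'k) mpoly). vscale (Cst c) g"
  by unfold_locales (auto simp: fun_eq_iff Cst_add Cst_mult algebra_simps)

declare kvect.scale_scale [simp del]

text \<open>
  The coefficients exist in the free module. Applying the generators \<open>a\<close> to them gives a cycle of the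
  Koszul complex on \<open>R\<close>, hence three multiples of an element \<open>t\<close>. All multiples of \<open>t\<close> by variables lie
  in the ideal, so \<open>t\<close> does, and a preimage of \<open>t\<close> corrects the coefficients to syzygies.
\<close>

lemma syz_koszul_exact:
  fixes a :: "'j \<Rightarrow> (3, 'k::field) mpoly"
  assumes J: "finite J"
    and socle: "\<forall>t. (\<forall>i. Var i * t \<in> combinations J a) \<longrightarrow> t \<in> combinations J a"
    and UVW: "U \<in> syz J a" "V \<in> syz J a" "W \<in> syz J a"
    and 0: "vscale (Var 1) U + vscale (Var 2) V + vscale (Var 3) W = 0"
  obtains \<alpha> \<beta> \<gamma> where "\<alpha> \<in> syz J a" "\<beta> \<in> syz J a" "\<gamma> \<in> syz J a"
    "U = vscale (Var 2) \<alpha> + vscale (Var 3) \<beta>"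
    "V = - vscale (Var 1) \<alpha> + vscale (Var 3) \<gamma>"
    "W = - vscale (Var 1) \<beta> - vscale (Var 2) \<gamma>"
proof -
  let ?x = "Var 1 :: (3, 'k) mpoly" and ?y = "Var 2 :: (3, 'k) mpoly" and ?z = "Var 3 :: (3, 'k) mpoly"
  have ne: "(1::3) \<noteq> 2" "(1::3) \<noteq> 3" "(2::3) \<noteq> 3" by simp_all
  have "\<exists>p q r. U j = ?y * p + ?z * q \<and> V j = - (?x * p) + ?z * r \<and> W j = - (?x * q) - ?y * r" for j
  proof -
    have "?x * U j + ?y * V j + ?z * W j = 0" using fun_cong[OF 0, of j] by simp
    from Var_koszul_exact[OF ne this] show ?thesis by metis
  qed
  then obtain p q r where pqr: "\<And>j. U j = ?y * p j + ?z * q j" "\<And>j. V j = - (?x * p j) + ?z * r j"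
    "\<And>j. W j = - (?x * q j) - ?y * r j" by metis
  have U: "U = vscale ?y p + vscale ?z q" and V: "V = vscale ?z r - vscale ?x p"
    using pqr by (auto simp: fun_eq_iff)
  have "?y * dot J a p + ?z * dot J a q = 0"
    using UVW(1) unfolding U by (simp only: dot_add dot_scale syz_def mem_Collect_eq)
  moreover have "- (?x * dot J a p) + ?z * dot J a r = 0"
    using UVW(2) unfolding V by (simp only: dot_diff dot_scale syz_def mem_Collect_eq) simp
  ultimately obtain t where t: "dot J a p = ?z * t" "dot J a q = - (?y * t)" "dot J a r = ?x * t"
    using Var_koszul_exact_2[OF ne] by metis
  have "Var i * t \<in> combinations J a" for i
  proof -
    have "?x * t \<in> combinations J a" "?z * t \<in> combinations J a"
      unfolding combinations_def t[symmetric] by simp_all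
    moreover have "?y * t = dot J a (- q)" using t(2) by (simp add: dot_def sum_negf)
    then have "?y * t \<in> combinations J a" unfolding combinations_def by simp
    ultimately show ?thesis using exhaust_3[of i] by auto
  qed
  then have "t \<in> combinations J a" using socle by blast
  then obtain \<tau> where \<tau>: "t = dot J a \<tau>" by (auto simp: combinations_def)
  let ?cut = "\<lambda>g j. if j \<in> J then g j else 0 :: (3, 'k) mpoly"
  let ?\<alpha> = "?cut (p - vscale ?z \<tau>)" and ?\<beta> = "?cut (q + vscale ?y \<tau>)" and ?\<gamma> = "?cut (r - vscale ?x \<tau>)"
  have out: "U j = 0" "V j = 0" "W j = 0" if "j \<notin> J" for j
    using UVW that by (auto simp: syz_def)
  show ?thesis
  proof (rule that)
    show "?\<alpha> \<in> syz J a" "?\<beta> \<in> syz J a" "?\<gamma> \<in> syz J a"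
      by (intro cut_in_syz; simp only: dot_diff dot_add dot_scale t \<tau>[symmetric]; simp)+
    show "U = vscale ?y ?\<alpha> + vscale ?z ?\<beta>"
      using pqr out by (auto simp: fun_eq_iff algebra_simps)
    show "V = - vscale ?x ?\<alpha> + vscale ?z ?\<gamma>"
      using pqr out by (auto simp: fun_eq_iff algebra_simps)
    show "W = - vscale ?x ?\<beta> - vscale ?y ?\<gamma>"
      using pqr out by (auto simp: fun_eq_iff algebra_simps)
  qed
qed

text \<open>
  The component of degree \<open>n\<close> in the free module whose \<open>j\<close>-th basis vector has degree \<open>\<delta> j\<close>. The map
  \<open>dot J a\<close> preserves degrees if \<open>a j\<close> is homogeneous of degree \<open>\<delta> j\<close>.
\<close>

definition gcomp :: "('j \<Rightarrow> nat) \<Rightarrow> nat \<Rightarrow> ('j \<Rightarrow> ('i, 'r::comm_ring_1) mpoly) \<Rightarrow> ('j \<Rightarrow> ('i, 'r) mpoly)" where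
  "gcomp \<delta> n g = (\<lambda>j. restr (\<lambda>m. mon_degree m + \<delta> j = n) (g j))"

lemma gcomp_add: "gcomp \<delta> n (g + g') = gcomp \<delta> n g + gcomp \<delta> n g'"
  by (simp add: gcomp_def fun_eq_iff restr_add)

lemma gcomp_0: "gcomp \<delta> n 0 = 0"
  by (simp add: gcomp_def fun_eq_iff)

lemma gcomp_Cst: "gcomp \<delta> n (vscale (Cst c) g) = vscale (Cst c) (gcomp \<delta> n g)"
  unfolding gcomp_def fun_eq_iff vscale_apply
  by (intro allI restr_mult) (auto simp: Cst_def split: if_splits)

lemma gcomp_Var: "gcomp \<delta> (Suc n) (vscale (Var i) g) = vscale (Var i) (gcomp \<delta> n g)"
  unfolding gcomp_def fun_eq_iff vscale_apply
  by (intro allI restr_mult) (auto simp: mon_degree_add)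

lemma gcomp_Var_0: "gcomp \<delta> 0 (vscale (Var i) g) = 0"
  unfolding gcomp_def fun_eq_iff vscale_apply
proof (intro allI)
  fix j
  show "restr (\<lambda>m. mon_degree m + \<delta> j = 0) (Var i * g j) = 0 j"
    using keys_mult[of "Var i" "g j"] by (auto intro!: restr_eq_0 simp: mon_degree_add)
qed

lemma gcomp_gcomp: "gcomp \<delta> n (gcomp \<delta> n' g) = (if n = n' then gcomp \<delta> n g else 0)"
  by (auto simp: gcomp_def fun_eq_iff keys_restr intro!: restr_eq_0 restr_id)

lemma gcomp_in_syz:
  assumes a: "\<And>j. j \<in> J \<Longrightarrow> homogeneous (\<delta> j) (a j)" and g: "g \<in> syz J a"
  shows "gcomp \<delta> n g \<in> syz J a"
proof -
  have "dot J a (gcomp \<delta> n g) = hcomp n (dot J a g)"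
    unfolding dot_def restr_sum
  proof (intro sum.cong refl)
    fix j assume "j \<in> J"
    then have "hcomp n (a j * g j) = a j * restr (\<lambda>m. mon_degree m + \<delta> j = n) (g j)"
      using a[of j] by (intro restr_mult) (auto simp: homogeneous_def mon_degree_add)
    then show "gcomp \<delta> n g j * a j = hcomp n (g j * a j)"
      by (simp add: gcomp_def mult.commute)
  qed
  then show ?thesis using g by (auto simp: syz_def gcomp_def)
qed

lemma sum_gcomp:
  assumes "finite J" "\<And>j. j \<notin> J \<Longrightarrow> g j = 0"
  obtains N where "(\<Sum>n\<le>N. gcomp \<delta> n g) = g"
proof -
  let ?D = "\<Union>j\<in>J. (\<lambda>m. mon_degree m + \<delta> j) ` Poly_Mapping.keys (g j)"
  have fin: "finite (insert 0 ?D)" using assms(1) by auto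
  have "(\<Sum>n\<le>Max (insert 0 ?D). gcomp \<delta> n g) = g"
  proof
    fix j
    have "(\<Sum>n\<le>Max (insert 0 ?D). restr (\<lambda>m. mon_degree m + \<delta> j = n) (g j)) = g j"
    proof (cases "j \<in> J")
      case True
      show ?thesis
      proof (rule restr_sum_degrees)
        fix m assume "m \<in> Poly_Mapping.keys (g j)"
        then show "mon_degree m + \<delta> j \<le> Max (insert 0 ?D)"
          using True by (intro Max_ge[OF fin]) auto
      qed
    qed (simp add: assms(2))
    then show "(\<Sum>n\<le>Max (insert 0 ?D). gcomp \<delta> n g) j = g j"
      by (simp add: sum_fun_apply gcomp_def)
  qed
  then show ?thesis by (rule that)
qed

lemma vect_span_coefficients:
  assumes "s \<in> vect.span B"
  obtains K r where "finite K" "K \<subseteq> B" "\<And>b. b \<notin> K \<Longrightarrow> r b = 0" "s = (\<Sum>b\<in>K. vscale (r b) b)"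
proof -
  obtain K r where K: "finite K" "K \<subseteq> B" "s = (\<Sum>b\<in>K. vscale (r b) b)"
    using assms by (auto simp: vect.span_explicit)
  show ?thesis
    by (rule that[of K "\<lambda>b. if b \<in> K then r b else 0"]) (use K in auto)
qed

text \<open>
  The coefficients \<open>\<rho>\<close> of a relation are divisible by arbitrarily high powers of the ideal of the variables.
  By minimality they have no constant terms. Writing them as \<open>x u + y v + z w\<close> gives three syzygies
  \<open>U, V, W\<close> with \<open>x U + y V + z W = 0\<close>, and Koszul exactness yields three new relations whose
  coefficients express \<open>\<rho>\<close> with one more factor.
\<close>

lemma independent_if_minimal:
  fixes a :: "'j \<Rightarrow> (3, 'k::field) mpoly"
  assumes J: "finite J"
    and socle: "\<forall>t. (\<forall>i. Var i * t \<in> combinations J a) \<longrightarrow> t \<in> combinations J a"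
    and B: "vect.span B = syz J a"
    and minimal: "\<And>K c p q r. finite K \<Longrightarrow> K \<subseteq> B \<Longrightarrow> p \<in> syz J a \<Longrightarrow> q \<in> syz J a \<Longrightarrow> r \<in> syz J a \<Longrightarrow>
      (\<Sum>b\<in>K. vscale (Cst (c b)) b) = vscale (Var 1) p + vscale (Var 2) q + vscale (Var 3) r \<Longrightarrow>
      \<forall>b\<in>K. c b = 0"
  shows "vect.independent B"
proof -
  let ?x = "Var 1 :: (3, 'k) mpoly" and ?y = "Var 2 :: (3, 'k) mpoly" and ?z = "Var 3 :: (3, 'k) mpoly"
  let ?lc = "\<lambda>K r. \<Sum>b\<in>K. vscale (r b) b"
  note syz_sub = syz_subspace[of J a]
  have B_syz: "b \<in> B \<Longrightarrow> b \<in> syz J a" for b using B vect.span_superset by blast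
  have order: "\<forall>b. order_ge N (\<rho> b)"
    if "finite K" "K \<subseteq> B" "\<And>b. b \<notin> K \<Longrightarrow> \<rho> b = 0" "?lc K \<rho> = 0" for N K \<rho>
    using that
  proof (induction N arbitrary: K \<rho>)
    case 0
    show ?case by (simp add: order_ge_def)
  next
    case (Suc N)
    note K = Suc.prems(1,2) and \<rho>_out = Suc.prems(3) and rel = Suc.prems(4)
    have "\<exists>c p q r. \<rho> b = Cst c + ?x * p + ?y * q + ?z * r" for b
      using mpoly3_decompose[of "\<rho> b"] by metis
    then obtain c p q r where "\<And>b. \<rho> b = Cst (c b) + ?x * p b + ?y * q b + ?z * r b" by metis
    \<comment> \<open>Zero outside of \<open>K\<close>, so that the sums can be taken over a larger set.\<close>
    define u v w where "u b = (if b \<in> K then p b else 0)" and "v b = (if b \<in> K then q b else 0)"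
      and "w b = (if b \<in> K then r b else 0)" for b
    have \<rho>: "\<rho> b = Cst (c b) + ?x * u b + ?y * v b + ?z * w b" if "b \<in> K" for b
      using that \<open>\<rho> b = _\<close> by (simp add: u_def v_def w_def)
    have lc_syz: "?lc K f \<in> syz J a" for f
      using K B_syz by (intro vect.subspace_sum[OF syz_sub] vect.subspace_scale[OF syz_sub]) auto
    let ?U = "?lc K u" and ?V = "?lc K v" and ?W = "?lc K w"
    have "?lc K \<rho> = ?lc K (\<lambda>b. Cst (c b)) + (vscale ?x ?U + vscale ?y ?V + vscale ?z ?W)"
    proof -
      have "?lc K \<rho> = (\<Sum>b\<in>K. vscale (Cst (c b)) b + (vscale ?x (vscale (u b) b)
          + vscale ?y (vscale (v b) b) + vscale ?z (vscale (w b) b)))"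
        by (intro sum.cong refl) (simp add: \<rho> fun_eq_iff algebra_simps)
      then show ?thesis by (simp only: sum.distrib vect.scale_sum_right)
    qed
    then have split: "?lc K (\<lambda>b. Cst (c b)) = - (vscale ?x ?U + vscale ?y ?V + vscale ?z ?W)"
      using rel by (simp only: eq_neg_iff_add_eq_0)
    have "?lc K (\<lambda>b. Cst (c b)) = vscale ?x (- ?U) + vscale ?y (- ?V) + vscale ?z (- ?W)"
      unfolding split by (simp add: fun_eq_iff)
    then have c: "\<forall>b\<in>K. c b = 0"
      by (rule minimal[OF K, rotated -1]) (intro vect.subspace_neg[OF syz_sub] lc_syz)+
    then have "?lc K (\<lambda>b. Cst (c b)) = 0" by (intro sum.neutral) (simp add: fun_eq_iff)
    then have "vscale ?x ?U + vscale ?y ?V + vscale ?z ?W = 0" using split by (simp only: neg_equal_0_iff_equal)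
    from syz_koszul_exact[OF J socle lc_syz lc_syz lc_syz this]
    obtain \<alpha> \<beta> \<gamma> where s: "\<alpha> \<in> syz J a" "\<beta> \<in> syz J a" "\<gamma> \<in> syz J a"
      and U: "?U = vscale ?y \<alpha> + vscale ?z \<beta>" and V: "?V = - vscale ?x \<alpha> + vscale ?z \<gamma>"
      and W: "?W = - vscale ?x \<beta> - vscale ?y \<gamma>"
      .
    obtain K1 \<alpha>' where 1: "finite K1" "K1 \<subseteq> B" "\<And>b. b \<notin> K1 \<Longrightarrow> \<alpha>' b = 0" "\<alpha> = ?lc K1 \<alpha>'"
      using vect_span_coefficients s(1) unfolding B[symmetric] by blast
    obtain K2 \<beta>' where 2: "finite K2" "K2 \<subseteq> B" "\<And>b. b \<notin> K2 \<Longrightarrow> \<beta>' b = 0" "\<beta> = ?lc K2 \<beta>'"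
      using vect_span_coefficients s(2) unfolding B[symmetric] by blast
    obtain K3 \<gamma>' where 3: "finite K3" "K3 \<subseteq> B" "\<And>b. b \<notin> K3 \<Longrightarrow> \<gamma>' b = 0" "\<gamma> = ?lc K3 \<gamma>'"
      using vect_span_coefficients s(3) unfolding B[symmetric] by blast
    define L where "L = K \<union> K1 \<union> K2 \<union> K3"
    have L: "finite L" "L \<subseteq> B" using K 1 2 3 by (auto simp: L_def)
    have extend: "?lc M f = ?lc L f" if "M \<subseteq> L" "\<And>b. b \<notin> M \<Longrightarrow> f b = 0" for M f
      using that L by (intro sum.mono_neutral_left) auto
    have "?U = ?lc L u" "?V = ?lc L v" "?W = ?lc L w"
      by (rule extend; simp add: L_def u_def v_def w_def; blast)+
    moreover have "\<alpha> = ?lc L \<alpha>'" "\<beta> = ?lc L \<beta>'" "\<gamma> = ?lc L \<gamma>'"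
      unfolding 1(4) 2(4) 3(4) by (rule extend; (auto simp: L_def 1 2 3)[1])+
    ultimately have rels: "?lc L u = vscale ?y (?lc L \<alpha>') + vscale ?z (?lc L \<beta>')"
      "?lc L v = - vscale ?x (?lc L \<alpha>') + vscale ?z (?lc L \<gamma>')"
      "?lc L w = - vscale ?x (?lc L \<beta>') - vscale ?y (?lc L \<gamma>')"
      using U V W by (simp_all only:)
    let ?u = "\<lambda>b. u b - ?y * \<alpha>' b - ?z * \<beta>' b"
    let ?v = "\<lambda>b. v b + ?x * \<alpha>' b - ?z * \<gamma>' b"
    let ?w = "\<lambda>b. w b + ?x * \<beta>' b + ?y * \<gamma>' b"
    have lc_0: "?lc L ?u = 0" "?lc L ?v = 0" "?lc L ?w = 0"
    proof -
      have "?lc L ?u = ?lc L u - vscale ?y (?lc L \<alpha>') - vscale ?z (?lc L \<beta>')"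
        by (simp add: fun_eq_iff sum_fun_apply sum_distrib_left algebra_simps sum.distrib sum_subtractf)
      then show "?lc L ?u = 0" unfolding rels(1) by simp
      have "?lc L ?v = ?lc L v + vscale ?x (?lc L \<alpha>') - vscale ?z (?lc L \<gamma>')"
        by (simp add: fun_eq_iff sum_fun_apply sum_distrib_left algebra_simps sum.distrib sum_subtractf)
      then show "?lc L ?v = 0" unfolding rels(2) by simp
      have "?lc L ?w = ?lc L w + vscale ?x (?lc L \<beta>') + vscale ?y (?lc L \<gamma>')"
        by (simp add: fun_eq_iff sum_fun_apply sum_distrib_left algebra_simps sum.distrib sum_subtractf)
      then show "?lc L ?w = 0" unfolding rels(3) by simp
    qed
    have out: "?u b = 0" "?v b = 0" "?w b = 0" if "b \<notin> L" for b
      using that 1(3)[of b] 2(3)[of b] 3(3)[of b] by (auto simp: L_def u_def v_def w_def)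
    have ord: "order_ge N (?u b)" "order_ge N (?v b)" "order_ge N (?w b)" for b
      using Suc.IH[OF L out(1) lc_0(1)] Suc.IH[OF L out(2) lc_0(2)] Suc.IH[OF L out(3) lc_0(3)]
      by blast+
    show ?case
    proof
      fix b
      show "order_ge (Suc N) (\<rho> b)"
      proof (cases "b \<in> K")
        case True
        then have "\<rho> b = ?x * ?u b + ?y * ?v b + ?z * ?w b"
          using c by (simp add: \<rho> algebra_simps)
        then show ?thesis using ord by (simp only: order_ge_add order_ge_Var_mult)
      qed (simp add: \<rho>_out order_ge_def)
    qed
  qed
  show ?thesis
    unfolding vect.independent_explicit_module
  proof (intro allI impI)
    fix K \<rho> b assume K: "finite K" "K \<subseteq> B" "?lc K \<rho> = 0" "b \<in> K"
    have "order_ge N (if b \<in> K then \<rho> b else 0)" for N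
      using order[OF K(1,2), of "\<lambda>b. if b \<in> K then \<rho> b else 0" N] K(3) by (auto cong: sum.cong)
    then show "\<rho> b = 0" using order_ge_all_0 K(4) by force
  qed
qed

text \<open>
  The set \<open>B\<close> consists of homogeneous syzygies that form a vector space basis of the syzygies modulo the
  multiples \<open>mF\<close> of the variables; it is found by extending a basis of \<open>mF\<close>. It generates by induction
  on the degree, as in the graded Nakayama lemma.
\<close>

theorem syz_free:
  fixes a :: "'j \<Rightarrow> (3, 'k::field) mpoly"
  assumes J: "finite J" and a: "\<And>j. j \<in> J \<Longrightarrow> homogeneous (\<delta> j) (a j)"
    and socle: "\<forall>t. (\<forall>i. Var i * t \<in> combinations J a) \<longrightarrow> t \<in> combinations J a"
  obtains B where "vect.independent B" "vect.span B = syz J a"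
proof -
  let ?x = "Var 1 :: (3, 'k) mpoly" and ?y = "Var 2 :: (3, 'k) mpoly" and ?z = "Var 3 :: (3, 'k) mpoly"
  let ?mul = "\<lambda>p q r. vscale ?x p + vscale ?y q + vscale ?z r"
  note syz_sub = syz_subspace[of J a]
  define mF where "mF = {?mul p q r | p q r. p \<in> syz J a \<and> q \<in> syz J a \<and> r \<in> syz J a}"
  define H where "H = {g \<in> syz J a. \<exists>n. gcomp \<delta> n g = g}"
  have mF_sub: "kvect.subspace mF"
  proof (rule kvect.subspaceI)
    have "0 = ?mul 0 0 0" by simp
    then show "0 \<in> mF" using vect.subspace_0[OF syz_sub] unfolding mF_def by blast
  next
    fix f g assume "f \<in> mF" "g \<in> mF"
    then obtain p q r p' q' r' where pqr: "p \<in> syz J a" "q \<in> syz J a" "r \<in> syz J a"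
      "p' \<in> syz J a" "q' \<in> syz J a" "r' \<in> syz J a" and fg: "f = ?mul p q r" "g = ?mul p' q' r'"
      unfolding mF_def by blast
    have "f + g = ?mul (p + p') (q + q') (r + r')"
      unfolding fg by (simp add: vect.scale_right_distrib)
    then show "f + g \<in> mF"
      using vect.subspace_add[OF syz_sub] pqr unfolding mF_def by blast
  next
    fix c f assume "f \<in> mF"
    then obtain p q r where pqr: "p \<in> syz J a" "q \<in> syz J a" "r \<in> syz J a" and f: "f = ?mul p q r"
      unfolding mF_def by blast
    have "vscale (Cst c) f = ?mul (vscale (Cst c) p) (vscale (Cst c) q) (vscale (Cst c) r)"
      unfolding f by (simp add: fun_eq_iff algebra_simps)
    then show "vscale (Cst c) f \<in> mF"
      using vect.subspace_scale[OF syz_sub] pqr unfolding mF_def by blast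
  qed
  obtain A where A: "A \<subseteq> mF" "kvect.independent A" "mF \<subseteq> kvect.span A"
    using kvect.basis_exists by metis
  obtain B' where B': "A \<subseteq> B'" "B' \<subseteq> A \<union> H" "kvect.independent B'" "A \<union> H \<subseteq> kvect.span B'"
    using kvect.maximal_independent_subset_extend[of A "A \<union> H"] A(2) by blast
  define B where "B = B' - A"
  have B_H: "B \<subseteq> H" and B'_eq: "B' = A \<union> B" using B' by (auto simp: B_def)
  have span_A: "kvect.span A = mF"
    using A(1,3) mF_sub by (metis kvect.span_minimal subset_antisym)
  have B_syz: "b \<in> syz J a" if "b \<in> B" for b using that B_H by (auto simp: H_def)
  have gen: "s \<in> vect.span B" if "s \<in> syz J a" "gcomp \<delta> n s = s" for s n
    using that
  proof (induction n arbitrary: s rule: less_induct)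
    case (less n)
    have "s \<in> kvect.span (A \<union> B)" using less.prems B'(4) B'_eq by (auto simp: H_def)
    then obtain f y where s: "s = f + y" and f: "f \<in> mF" and y: "y \<in> kvect.span B"
      unfolding kvect.span_Un span_A by blast
    have s_eq: "s = gcomp \<delta> n f + gcomp \<delta> n y" using less.prems(2) s gcomp_add by metis
    have y_in: "gcomp \<delta> n y \<in> vect.span B"
      using y
    proof (induction rule: kvect.span_induct_alt)
      case base
      show ?case unfolding gcomp_0 by (rule vect.span_zero)
    next
      case (step c b y')
      obtain n' where n': "gcomp \<delta> n' b = b" using step B_H by (auto simp: H_def)
      have "gcomp \<delta> n b \<in> vect.span B"
        using gcomp_gcomp[of \<delta> n n' b] step(1) unfolding n'
        by (cases "n = n'") (simp_all only: if_True if_False n' vect.span_base vect.span_zero)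
      then show ?case
        unfolding gcomp_add gcomp_Cst by (intro vect.span_add vect.span_scale step.IH)
    qed
    obtain p q r where pqr: "p \<in> syz J a" "q \<in> syz J a" "r \<in> syz J a" and f_eq: "f = ?mul p q r"
      using f unfolding mF_def by blast
    have "gcomp \<delta> n f \<in> vect.span B"
    proof (cases n)
      case 0
      have "gcomp \<delta> n f = 0"
        unfolding f_eq 0 gcomp_add gcomp_Var_0 by simp
      then show ?thesis by (simp only: vect.span_zero)
    next
      case (Suc m)
      have "gcomp \<delta> m g \<in> vect.span B" if "g \<in> syz J a" for g
      proof (rule less.IH[of m])
        show "m < n" by (simp add: Suc)
        show "gcomp \<delta> m g \<in> syz J a" by (rule gcomp_in_syz[OF a that])
        show "gcomp \<delta> m (gcomp \<delta> m g) = gcomp \<delta> m g" unfolding gcomp_gcomp by simp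
      qed
      then show ?thesis
        unfolding f_eq Suc gcomp_add gcomp_Var using pqr
        by (intro vect.span_add vect.span_scale) auto
    qed
    then show ?case unfolding s_eq using y_in by (intro vect.span_add)
  qed
  have "syz J a \<subseteq> vect.span B"
  proof
    fix s assume s: "s \<in> syz J a"
    then obtain N where N: "(\<Sum>n\<le>N. gcomp \<delta> n s) = s"
      using sum_gcomp[OF J, of s \<delta>] by (auto simp: syz_def)
    have "gcomp \<delta> n s \<in> vect.span B" for n
    proof (rule gen[of _ n])
      show "gcomp \<delta> n s \<in> syz J a" by (rule gcomp_in_syz[OF a s])
      show "gcomp \<delta> n (gcomp \<delta> n s) = gcomp \<delta> n s" unfolding gcomp_gcomp by simp
    qed
    then have "(\<Sum>n\<le>N. gcomp \<delta> n s) \<in> vect.span B" by (intro vect.span_sum)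
    then show "s \<in> vect.span B" by (simp only: N)
  qed
  moreover have "vect.span B \<subseteq> syz J a"
    using B_syz by (intro vect.span_minimal syz_sub) auto
  ultimately have span_B: "vect.span B = syz J a" by blast
  have "vect.independent B"
  proof (rule independent_if_minimal[OF J socle span_B])
    fix K c p q r
    assume K: "finite K" "K \<subseteq> B" and pqr: "p \<in> syz J a" "q \<in> syz J a" "r \<in> syz J a"
      and eq: "(\<Sum>b\<in>K. vscale (Cst (c b)) b) = ?mul p q r"
    have "(\<Sum>b\<in>K. vscale (Cst (c b)) b) \<in> kvect.span A"
      unfolding span_A mF_def eq using pqr by blast
    then obtain T d where T: "finite T" "T \<subseteq> A"
      "(\<Sum>b\<in>K. vscale (Cst (c b)) b) = (\<Sum>t\<in>T. vscale (Cst (d t)) t)"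
      by (auto simp: kvect.span_explicit)
    \<comment> \<open>The two expansions of one vector give a linear relation on \<open>B'\<close>.\<close>
    define e where "e b = (if b \<in> K then c b else - d b)" for b
    have disj: "K \<inter> T = {}" using K(2) T(2) by (auto simp: B_def)
    have "(\<Sum>b\<in>K \<union> T. vscale (Cst (e b)) b)
        = (\<Sum>b\<in>K. vscale (Cst (e b)) b) + (\<Sum>b\<in>T. vscale (Cst (e b)) b)"
      by (rule sum.union_disjoint[OF K(1) T(1) disj])
    also have "(\<Sum>b\<in>K. vscale (Cst (e b)) b) = (\<Sum>b\<in>K. vscale (Cst (c b)) b)"
      by (intro sum.cong) (auto simp: e_def)
    also have "(\<Sum>b\<in>T. vscale (Cst (e b)) b) = (\<Sum>b\<in>T. - vscale (Cst (d b)) b)"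
      using disj by (intro sum.cong) (auto simp: e_def fun_eq_iff Cst_uminus)
    finally have "(\<Sum>b\<in>K \<union> T. vscale (Cst (e b)) b) = 0"
      unfolding sum_negf T(3) right_minus .
    moreover have "K \<union> T \<subseteq> B'" using K(2) T(2) B'_eq by blast
    ultimately have "e b = 0" if "b \<in> K" for b
      using kvect.independentD[OF B'(3), of "K \<union> T" e b] K T that by blast
    then show "\<forall>b\<in>K. c b = 0" by (auto simp: e_def)
  qed
  then show ?thesis using span_B by (rule that)
qed

section \<open>Ideals of points of the projective plane\<close>

text \<open>
  The polynomials that vanish on the whole line through \<open>v\<close>, also when the field is finite: the parameter
  of the line is a variable. As the kernel of a homomorphism into a polynomial ring it is prime.
\<close>

definition cone_ideal :: "('k::field ^ 3) \<Rightarrow> (3, 'k) mpoly set" where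
  "cone_ideal v = {F. mpoly_eval (\<lambda>c. [:c:]) (\<lambda>i. monom (v $ i) 1) F = 0}"

lemma cone_ideal_iff: "F \<in> cone_ideal v \<longleftrightarrow> (\<forall>d. eval (\<lambda>i. v $ i) (hcomp d F) = 0)"
  by (simp add: cone_ideal_def poly_eq_iff coeff_eval_cone del: One_nat_def)

lemma cone_ideal_subspace: "ideal.subspace (cone_ideal v)"
  by (rule ideal.subspaceI) (auto simp: cone_ideal_def rees.eval_simps)

lemma cone_ideal_prime: "F * G \<in> cone_ideal v \<Longrightarrow> F \<in> cone_ideal v \<or> G \<in> cone_ideal v"
  by (simp add: cone_ideal_def rees.eval_simps)

lemma point_ideal_eq_cone_ideal:
  fixes v :: "'k::field ^ 3"
  assumes "v \<noteq> 0"
  shows "point_ideal (proj_rel `` {v}) = cone_ideal v"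
proof
  have "(v, v) \<in> proj_rel"
    using assms by (auto simp: proj_rel_def intro!: exI[of _ 1])
  then show "point_ideal (proj_rel `` {v}) \<subseteq> cone_ideal v"
    unfolding point_ideal_def id_def
    by (intro ideal.span_minimal cone_ideal_subspace) (auto simp: cone_ideal_iff hcomp_homogeneous eval.eval_0)
  show "cone_ideal v \<subseteq> point_ideal (proj_rel `` {v})"
  proof
    fix F assume F: "F \<in> cone_ideal v"
    obtain N where N: "(\<Sum>d\<le>N. hcomp d F) = F"
      using sum_hcomp[of F] by blast
    have "hcomp d F \<in> point_ideal (proj_rel `` {v})" for d
      unfolding point_ideal_def id_def
    proof (rule ideal.span_base, safe)
      show "\<exists>e. homogeneous e (hcomp d F)" using homogeneous_hcomp by blast
      fix w assume "(v, w) \<in> proj_rel"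
      then obtain c where "w = c *s v" by (auto simp: proj_rel_def)
      then have "(\<lambda>i. w $ i) = (\<lambda>i. v $ i * c)" by auto
      then have "eval (\<lambda>i. w $ i) (hcomp d F) = eval (\<lambda>i. v $ i) (hcomp d F) * c ^ d"
        using eval.eval_homogeneous_scaled[OF homogeneous_hcomp, of "\<lambda>i. v $ i" c d F] by simp
      then show "eval (\<lambda>i. w $ i) (hcomp d F) = 0"
        using F by (simp add: cone_ideal_iff)
    qed
    then have "(\<Sum>d\<le>N. hcomp d F) \<in> point_ideal (proj_rel `` {v})"
      unfolding point_ideal_def by (intro ideal.span_sum) auto
    then show "F \<in> point_ideal (proj_rel `` {v})" by (simp add: N)
  qed
qed

text \<open>
  In the chart \<open>v $ c \<noteq> 0\<close> the two forms with \<open>i \<noteq> c\<close> define the point.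
\<close>

definition line_form :: "('k::field ^ 3) \<Rightarrow> 3 \<Rightarrow> 3 \<Rightarrow> (3, 'k) mpoly" where
  "line_form v c i = Var i - Cst (v $ i / v $ c) * Var c"

lemma line_form_in_cone_ideal:
  "v $ c \<noteq> 0 \<Longrightarrow> line_form v c i \<in> cone_ideal v"
  by (simp add: line_form_def cone_ideal_def rees.eval_simps smult_monom)

lemma line_form_neq_0: "i \<noteq> c \<Longrightarrow> line_form v c i \<noteq> 0"
proof
  assume "i \<noteq> c" "line_form v c i = 0"
  then have "eval (\<lambda>j. if j = i then 1 else 0) (line_form v c i) = 0" by (simp add: eval.eval_0)
  with \<open>i \<noteq> c\<close> show False by (simp add: line_form_def eval.eval_simps)
qed

lemma line_form_dvd_cancel:
  assumes "i \<noteq> j" "i \<noteq> c" "j \<noteq> c" "line_form v c i dvd line_form v c j * P"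
  shows "line_form v c i dvd P"
proof -
  let ?s = "\<lambda>k. if k = i then Cst (v $ i / v $ c) * Var c else Var k :: (3, 'a) mpoly"
  have "Var k - ?s k \<in> ideal_gen {line_form v c i}" for k
    by (simp add: ideal_gen_1) (simp add: line_form_def)
  then have "P - subst ?s P \<in> ideal_gen {line_form v c i}"
    by (rule subst_congruent_mod)
  moreover obtain Q where Q: "line_form v c j * P = line_form v c i * Q" using assms(4) by (elim dvdE)
  have i0: "subst ?s (line_form v c i) = 0"
    using assms(2) by (simp add: line_form_def subst.eval_simps)
  have j0: "subst ?s (line_form v c j) = line_form v c j"
    using assms(1,2) by (simp add: line_form_def subst.eval_simps)
  have "subst ?s (line_form v c j * P) = subst ?s (line_form v c i * Q)" using Q by simp
  then have "subst ?s P = 0"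
    using line_form_neq_0[OF assms(3), of v] by (simp only: subst.eval_mult i0 j0) simp
  ultimately show ?thesis by (simp add: ideal_gen_1)
qed

text \<open>
  Substituting \<open>v $ l / v $ c\<close> times the variable \<open>c\<close> for each variable \<open>l\<close> is restriction to the line
  through \<open>v\<close>, so it kills the polynomials of the cone ideal.
\<close>

lemma cone_ideal_generators:
  fixes v :: "'k::field ^ 3"
  assumes c: "v $ c \<noteq> 0" and U: "\<And>l. l = c \<or> l = i \<or> l = j" and F: "F \<in> cone_ideal v"
  shows "\<exists>u w. F = u * line_form v c i + w * line_form v c j"
proof -
  let ?y = "Cst (inverse (v $ c)) * Var c :: (3, 'k) mpoly"
  let ?s = "\<lambda>l. Cst (v $ l) * ?y"
  have "Var l - ?s l \<in> ideal_gen {line_form v c i, line_form v c j}" for l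
  proof -
    have "Var l - ?s l = line_form v c l"
      by (simp add: line_form_def divide_inverse Cst_mult mult_ac)
    moreover have "line_form v c c = 0" using c by (simp add: line_form_def)
    ultimately show ?thesis using U[of l] by (auto intro: ideal.span_base simp: ideal.span_zero)
  qed
  then have "F - subst ?s F \<in> ideal_gen {line_form v c i, line_form v c j}"
    by (rule subst_congruent_mod)
  moreover obtain N where N: "(\<Sum>d\<le>N. hcomp d F) = F"
    using sum_hcomp[of F] by blast
  have "subst ?s (hcomp d F) = 0" for d
    using F by (subst subst.eval_homogeneous_scaled[OF homogeneous_hcomp]) (simp add: cone_ideal_iff)
  then have "subst ?s (\<Sum>d\<le>N. hcomp d F) = 0" by (simp only: subst.eval_sum sum.neutral_const)
  then have "subst ?s F = 0" by (simp only: N)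
  ultimately show ?thesis by (simp add: ideal_gen_2)
qed

lemma cone_ideal_complete_intersection:
  fixes v :: "'k::field ^ 3"
  assumes "v \<noteq> 0"
  obtains l l' where "l \<noteq> 0" "l' \<noteq> 0" "l \<in> cone_ideal v" "l' \<in> cone_ideal v"
    "\<forall>x. l dvd l' * x \<longrightarrow> l dvd x" "\<forall>x. l' dvd l * x \<longrightarrow> l' dvd x"
    "\<forall>F\<in>cone_ideal v. \<exists>u w. F = u * l + w * l'"
proof -
  obtain c where c: "v $ c \<noteq> 0" using assms by (auto simp: vec_eq_iff)
  obtain i j :: 3 where ij: "i \<noteq> j" "i \<noteq> c" "j \<noteq> c" "\<And>l. l = c \<or> l = i \<or> l = j"
  proof -
    have U: "l = 1 \<or> l = 2 \<or> l = 3" for l :: 3 by (rule exhaust_3)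
    have ne: "(1::3) \<noteq> 2" "(1::3) \<noteq> 3" "(2::3) \<noteq> 3" by simp_all
    consider "c = 1" | "c = 2" | "c = 3" using U by blast
    then show ?thesis
    proof cases
      case 1 show ?thesis by (rule that[of 2 3]) (use 1 U ne in auto)
    next
      case 2 show ?thesis by (rule that[of 1 3]) (use 2 U ne in auto)
    next
      case 3 show ?thesis by (rule that[of 1 2]) (use 3 U ne in auto)
    qed
  qed
  show ?thesis
  proof (rule that)
    show "line_form v c i \<noteq> 0" "line_form v c j \<noteq> 0" by (fact line_form_neq_0[OF ij(2)], fact line_form_neq_0[OF ij(3)])
    show "line_form v c i \<in> cone_ideal v" "line_form v c j \<in> cone_ideal v"
      using c by (auto intro: line_form_in_cone_ideal)
    show "\<forall>x. line_form v c i dvd line_form v c j * x \<longrightarrow> line_form v c i dvd x"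
      using line_form_dvd_cancel[OF ij(1-3)] by blast
    show "\<forall>x. line_form v c j dvd line_form v c i * x \<longrightarrow> line_form v c j dvd x"
      using line_form_dvd_cancel[OF ij(1)[symmetric] ij(3,2)] by blast
    show "\<forall>F\<in>cone_ideal v. \<exists>u w. F = u * line_form v c i + w * line_form v c j"
      using cone_ideal_generators[OF c ij(4)] by blast
  qed
qed

lemma cone_ideal_separates:
  fixes v v' :: "'k::field ^ 3"
  assumes v: "v \<noteq> 0" "v' \<noteq> 0" and "proj_rel `` {v} \<noteq> proj_rel `` {v'}"
  shows "\<exists>F. F \<in> cone_ideal v' \<and> F \<notin> cone_ideal v"
proof (rule ccontr)
  assume "\<nexists>F. F \<in> cone_ideal v' \<and> F \<notin> cone_ideal v"
  moreover obtain c where c: "v' $ c \<noteq> 0" using v(2) by (auto simp: vec_eq_iff)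
  ultimately have "line_form v' c i \<in> cone_ideal v" for i
    using line_form_in_cone_ideal by blast
  then have *: "monom (v $ i) 1 - [:v' $ i / v' $ c:] * monom (v $ c) 1 = 0" for i
    unfolding line_form_def cone_ideal_def mem_Collect_eq rees.eval_diff rees.eval_mult
      rees.eval_Cst rees.eval_Var .
  have eq: "v $ i = v' $ i / v' $ c * v $ c" for i
    using arg_cong[OF *[of i], of "\<lambda>p. coeff p 1"] by simp
  have "v $ c \<noteq> 0"
  proof
    assume "v $ c = 0"
    then have "v $ i = 0" for i using eq[of i] by simp
    then show False using v(1) by (simp add: vec_eq_iff)
  qed
  moreover have "v = (v $ c / v' $ c) *s v'"
    unfolding vec_eq_iff vector_smult_component
  proof
    fix i show "v $ i = v $ c / v' $ c * v' $ i" using eq[of i] by (simp add: field_simps)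
  qed
  ultimately have "(v', v) \<in> proj_rel"
    unfolding proj_rel_def using v c by (intro CollectI case_prodI conjI exI[of _ "v $ c / v' $ c"]) auto
  then have "proj_rel `` {v'} = proj_rel `` {v}" by (rule equiv_class_eq[OF equiv_proj_rel])
  with assms(3) show False by simp
qed

lemma proj_plane_point:
  assumes "p \<in> proj_plane"
  obtains v where "v \<noteq> 0" "p = proj_rel `` {v}" "point_ideal p = cone_ideal v"
  using assms point_ideal_eq_cone_ideal by (auto simp: proj_plane_def quotient_def)

lemma point_ideal_subspace: "p \<in> proj_plane \<Longrightarrow> ideal.subspace (point_ideal p)"
  by (metis proj_plane_point cone_ideal_subspace)

lemma point_ideal_prime:
  "p \<in> proj_plane \<Longrightarrow> F * G \<in> point_ideal p \<Longrightarrow> F \<in> point_ideal p \<or> G \<in> point_ideal p"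
  by (metis proj_plane_point cone_ideal_prime)

lemma hcomp_in_point_ideal:
  assumes "p \<in> proj_plane" "F \<in> point_ideal p" shows "hcomp d F \<in> point_ideal p"
proof -
  obtain v where v: "point_ideal p = cone_ideal v" using proj_plane_point[OF assms(1)] .
  show ?thesis
    using assms(2) unfolding v cone_ideal_iff hcomp_homogeneous[OF homogeneous_hcomp]
    by (auto simp: eval.eval_0)
qed

text \<open>
  Some coordinate of the point is nonzero, so some variable lies outside of the prime ideal.
\<close>

lemma point_ideal_socle:
  assumes "p \<in> proj_plane" "\<And>i. Var i * t \<in> point_ideal p" shows "t \<in> point_ideal p"
proof -
  obtain v where v: "v \<noteq> 0" "point_ideal p = cone_ideal v" using proj_plane_point[OF assms(1)] .
  obtain c where "v $ c \<noteq> 0" using v(1) by (auto simp: vec_eq_iff)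
  then have "Var c \<notin> cone_ideal v" by (simp add: cone_ideal_def rees.eval_simps)
  then show ?thesis using assms(2)[of c] cone_ideal_prime v(2) by blast
qed

lemma vanishing_ideal_subspace:
  assumes "X \<subseteq> proj_plane" shows "ideal.subspace (vanishing_ideal X)"
  unfolding vanishing_ideal_def using assms point_ideal_subspace
  by (intro ideal.subspace_Inter) blast

lemma hcomp_in_vanishing_ideal:
  "X \<subseteq> proj_plane \<Longrightarrow> F \<in> vanishing_ideal X \<Longrightarrow> hcomp d F \<in> vanishing_ideal X"
  unfolding vanishing_ideal_def using hcomp_in_point_ideal by blast

lemma vanishing_ideal_socle:
  assumes "X \<subseteq> proj_plane" "\<And>i. Var i * t \<in> vanishing_ideal X" shows "t \<in> vanishing_ideal X"
  unfolding vanishing_ideal_def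
proof
  fix p assume p: "p \<in> X"
  show "t \<in> point_ideal p"
  proof (rule point_ideal_socle)
    show "p \<in> proj_plane" using p assms(1) by blast
    show "Var i * t \<in> point_ideal p" for i using assms(2)[of i] p by (simp add: vanishing_ideal_def)
  qed
qed

lemma dvd_of_dvd_mult_squares:
  fixes h l l' :: "'r::idom"
  assumes h: "h \<noteq> 0" "l \<noteq> 0" and reg: "\<And>x. l dvd l' * x \<Longrightarrow> l dvd x"
    and dvd: "h dvd l\<^sup>2 * s" "h dvd l'\<^sup>2 * s"
  shows "h dvd s"
proof -
  obtain \<alpha> \<beta> where \<alpha>: "l\<^sup>2 * s = h * \<alpha>" and \<beta>: "l'\<^sup>2 * s = h * \<beta>" using dvd by (auto elim!: dvdE)
  have "h * (l' * (l' * \<alpha>)) = l'\<^sup>2 * (l\<^sup>2 * s)" unfolding \<alpha> by (simp add: power2_eq_square mult_ac)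
  also have "\<dots> = l\<^sup>2 * (h * \<beta>)" unfolding \<beta>[symmetric] by (simp add: mult_ac)
  also have "\<dots> = h * (l * (l * \<beta>))" by (simp add: power2_eq_square mult_ac)
  finally have 1: "l' * (l' * \<alpha>) = l * (l * \<beta>)" using h by simp
  have "l dvd l' * (l' * \<alpha>)" unfolding 1 by simp
  then have "l dvd \<alpha>" using reg by blast
  then obtain \<alpha>1 where \<alpha>1: "\<alpha> = l * \<alpha>1" by (elim dvdE)
  have "l * (l' * (l' * \<alpha>1)) = l * (l * \<beta>)" using 1 unfolding \<alpha>1 by (simp add: mult_ac)
  then have "l' * (l' * \<alpha>1) = l * \<beta>" using h by simp
  then have "l dvd l' * (l' * \<alpha>1)" by simp
  then have "l dvd \<alpha>1" using reg by blast
  then obtain \<alpha>2 where "\<alpha>1 = l * \<alpha>2" by (elim dvdE)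
  then have "l\<^sup>2 * s = l\<^sup>2 * (h * \<alpha>2)" using \<alpha> \<alpha>1 by (simp add: power2_eq_square mult_ac)
  then show ?thesis using h by simp
qed

text \<open>
  The ideal has grade at least two, in a form that is stable under products: the squares \<open>l\<^sup>2, l'\<^sup>2\<close> for
  one point form a regular sequence, and multiples of \<open>u\<close> by \<open>l\<close> and \<open>l'\<close> allow adding this point to
  the set.
\<close>

lemma vanishing_ideal_grade:
  fixes X :: "('k::field ^ 3) set set"
  assumes "finite X" "X \<subseteq> proj_plane" "h \<noteq> 0" "\<And>u. u \<in> vanishing_ideal X \<Longrightarrow> h dvd u\<^sup>2 * r"
  shows "h dvd r"
  using assms(1,2,4)
proof (induction X arbitrary: r rule: finite_induct)
  case empty
  then show ?case using empty.prems(2)[of 1] by (simp add: vanishing_ideal_def)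
next
  case (insert p X)
  have p: "p \<in> proj_plane" using insert.prems(1) by blast
  obtain v where v: "v \<noteq> 0" "p = proj_rel `` {v}" "point_ideal p = cone_ideal v"
    using proj_plane_point[OF p] .
  obtain l l' where l: "l \<noteq> 0" "l' \<noteq> 0" "l \<in> cone_ideal v" "l' \<in> cone_ideal v"
    and reg: "\<forall>x. l dvd l' * x \<longrightarrow> l dvd x" "\<forall>x. l' dvd l * x \<longrightarrow> l' dvd x"
    and gen: "\<forall>F\<in>cone_ideal v. \<exists>u w. F = u * l + w * l'"
    using cone_ideal_complete_intersection[OF v(1)] .
  have X: "X \<subseteq> proj_plane" using insert.prems(1) by blast
  show ?case
  proof (rule insert.IH[OF X])
    fix u assume u: "u \<in> vanishing_ideal X"
    have "h dvd g\<^sup>2 * (u\<^sup>2 * r)" if "g \<in> cone_ideal v" for g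
    proof -
      have "u * g \<in> point_ideal p"
        unfolding v(3) by (rule ideal.subspace_scale[OF cone_ideal_subspace that])
      moreover have "g * u \<in> vanishing_ideal X"
        by (rule ideal.subspace_scale[OF vanishing_ideal_subspace[OF X] u])
      ultimately have "g * u \<in> vanishing_ideal (insert p X)"
        by (simp add: vanishing_ideal_def mult.commute)
      from insert.prems(2)[OF this] show ?thesis by (simp add: power_mult_distrib mult.assoc)
    qed
    then show "h dvd u\<^sup>2 * r"
      using dvd_of_dvd_mult_squares[OF assms(3) l(1) reg(1)[rule_format]] l(3,4) by blast
  qed
qed

text \<open>
  A product of factors that vanish at one point of \<open>X\<close> each and not at \<open>p\<close>; the ideal of \<open>p\<close> is prime.
\<close>

lemma point_separator:
  fixes X :: "('k::field ^ 3) set set"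
  assumes X: "finite X" "X \<subseteq> proj_plane" and p: "p \<in> proj_plane" "p \<notin> X"
  shows "\<exists>g. g \<in> vanishing_ideal X \<and> g \<notin> point_ideal p"
  using assms
proof (induction X rule: finite_induct)
  case empty
  obtain v where "point_ideal p = cone_ideal v" using proj_plane_point[OF p(1)] .
  then have "1 \<notin> point_ideal p" by (simp add: cone_ideal_def rees.eval_simps)
  then show ?case by (auto simp: vanishing_ideal_def)
next
  case (insert q X)
  then obtain g where g: "g \<in> vanishing_ideal X" "g \<notin> point_ideal p" by auto
  have q: "q \<in> proj_plane" and X: "X \<subseteq> proj_plane" using insert.prems by auto
  obtain v where v: "v \<noteq> 0" "p = proj_rel `` {v}" "point_ideal p = cone_ideal v"
    using proj_plane_point[OF p(1)] .
  obtain v' where v': "v' \<noteq> 0" "q = proj_rel `` {v'}" "point_ideal q = cone_ideal v'"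
    using proj_plane_point[OF q] .
  have "proj_rel `` {v} \<noteq> proj_rel `` {v'}" using insert.prems(3) v(2) v'(2) by blast
  then obtain F where F: "F \<in> point_ideal q" "F \<notin> point_ideal p"
    using cone_ideal_separates[OF v(1) v'(1)] v(3) v'(3) by blast
  have "F * g \<in> vanishing_ideal X"
    by (rule ideal.subspace_scale[OF vanishing_ideal_subspace[OF X] g(1)])
  moreover have "g * F \<in> point_ideal q"
    by (rule ideal.subspace_scale[OF point_ideal_subspace[OF q] F(1)])
  ultimately have "F * g \<in> vanishing_ideal (insert q X)"
    by (simp add: vanishing_ideal_def mult.commute)
  moreover have "F * g \<notin> point_ideal p" using point_ideal_prime[OF p(1)] F(2) g(2) by blast
  ultimately show ?case by blast
qed

text \<open>
  The generators are first replaced by their homogeneous components. For each point \<open>p\<close> the separator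
  \<open>g p\<close> gives an annihilator \<open>(g p)\<^sup>2\<close> of the class of a quadratic relation. The sum \<open>h\<close> of these
  annihilators is congruent to \<open>(g p)\<^sup>2\<close> modulo the ideal of \<open>p\<close>, so it lies in none of these primes and
  is a nonzerodivisor modulo their intersection.
\<close>

theorem vanishing_ideal_syzygetic:
  fixes X :: "('k::field ^ 3) set set" and f :: "'i \<Rightarrow> (3, 'k) mpoly"
  assumes X: "finite X" "X \<subseteq> proj_plane"
    and J': "finite J'" and f: "combinations J' f = vanishing_ideal X"
    and w: "w \<in> quadratics J'" "eval f w = 0"
  shows "w \<in> syz_products J' f"
proof -
  let ?I = "vanishing_ideal X"
  note I_sub = vanishing_ideal_subspace[OF X(2)]
  obtain N where N: "\<And>i n. N i \<le> n \<Longrightarrow> (\<Sum>d\<le>n. hcomp d (f i)) = f i"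
  proof -
    have "\<exists>N. \<forall>n\<ge>N. (\<Sum>d\<le>n. hcomp d (f i)) = f i" for i by (metis sum_hcomp)
    then show ?thesis using that by metis
  qed
  define D where "D = Max (insert 0 (N ` J'))"
  have D: "(\<Sum>d\<le>D. hcomp d (f i)) = f i" if "i \<in> J'" for i
    by (rule N) (use J' that in \<open>auto simp: D_def\<close>)
  define J where "J = J' \<times> {..D}"
  define a where "a = (\<lambda>(i, d). hcomp d (f i))"
  have J: "finite J" using J' by (simp add: J_def)
  have f_I: "f i \<in> ?I" if "i \<in> J'" for i using combinations_base[OF J' that] f by metis
  have a_I: "a j \<in> ?I" if "j \<in> J" for j
    using that f_I hcomp_in_vanishing_ideal[OF X(2)] by (auto simp: J_def a_def)
  have f_combs: "f i \<in> combinations J a" if "i \<in> J'" for i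
  proof -
    have "hcomp d (f i) \<in> combinations J a" if "d \<le> D" for d
      using combinations_base[OF J, of "(i, d)" a] that \<open>i \<in> J'\<close> by (simp add: J_def a_def)
    then have "(\<Sum>d\<le>D. hcomp d (f i)) \<in> combinations J a"
      by (intro ideal.subspace_sum[OF combinations_subspace]) auto
    then show ?thesis by (simp only: D[OF that])
  qed
  have I_eq: "combinations J a = ?I"
  proof
    show "combinations J a \<subseteq> ?I"
      unfolding combinations_def dot_def using a_I
      by (auto intro!: ideal.subspace_sum[OF I_sub] ideal.subspace_scale[OF I_sub])
    show "?I \<subseteq> combinations J a"
      unfolding f[symmetric] combinations_def[of J'] dot_def using f_combs
      by (auto intro!: ideal.subspace_sum[OF combinations_subspace] ideal.subspace_scale[OF combinations_subspace])
  qed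
  have homog: "homogeneous (snd j) (a j)" for j
    by (cases j) (simp add: a_def homogeneous_hcomp)
  have socle: "\<forall>t. (\<forall>i. Var i * t \<in> combinations J a) \<longrightarrow> t \<in> combinations J a"
    unfolding I_eq using vanishing_ideal_socle[OF X(2)] by simp
  obtain B where B: "vect.independent B" "vect.span B = syz J a"
    using syz_free[OF J homog socle] .
  have main: "q \<in> syz_products J a" if q: "q \<in> quadratics J" "eval a q = 0" for q
  proof (cases "X = {}")
    case True
    \<comment> \<open>The unit ideal is handled as the complete intersection \<open>l = l' = 1\<close>.\<close>
    then have "combinations J a = UNIV" unfolding I_eq by (simp add: vanishing_ideal_def)
    then have "Cst (1\<^sup>2) * q \<in> syz_products J a"
      by (intro quadric_relation_local[OF J _ _ _ _ _ _ _ _ q, of 1 1]) (simp_all, metis add_0_right)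
    then show ?thesis by simp
  next
    case False
    have "\<forall>p\<in>X. \<exists>g. g \<in> vanishing_ideal (X - {p}) \<and> g \<notin> point_ideal p"
      using X by (intro ballI point_separator) auto
    from bchoice[OF this] obtain g where
      g: "\<And>p. p \<in> X \<Longrightarrow> g p \<in> vanishing_ideal (X - {p})" "\<And>p. p \<in> X \<Longrightarrow> g p \<notin> point_ideal p"
      by blast
    have gq: "Cst ((g p)\<^sup>2) * q \<in> syz_products J a" if p: "p \<in> X" for p
    proof -
      have pP: "p \<in> proj_plane" using p X(2) by blast
      obtain v where v: "v \<noteq> 0" "p = proj_rel `` {v}" "point_ideal p = cone_ideal v"
        using proj_plane_point[OF pP] .
      obtain l l' where l: "l \<noteq> 0" "l' \<noteq> 0" "l \<in> cone_ideal v" "l' \<in> cone_ideal v"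
        and reg: "\<forall>x. l dvd l' * x \<longrightarrow> l dvd x" "\<forall>x. l' dvd l * x \<longrightarrow> l' dvd x"
        and gen: "\<forall>F\<in>cone_ideal v. \<exists>u w. F = u * l + w * l'"
        using cone_ideal_complete_intersection[OF v(1)] .
      have gI: "g p * F \<in> combinations J a" if F: "F \<in> cone_ideal v" for F
        unfolding I_eq vanishing_ideal_def
      proof
        fix r assume r: "r \<in> X"
        show "g p * F \<in> point_ideal r"
        proof (cases "r = p")
          case True
          then show ?thesis using F v(3) ideal.subspace_scale[OF cone_ideal_subspace] by simp
        next
          case False
          then have "g p \<in> point_ideal r" using g(1)[OF p] r by (auto simp: vanishing_ideal_def)
          moreover have "r \<in> proj_plane" using r X(2) by blast
          ultimately have "F * g p \<in> point_ideal r"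
            by (intro ideal.subspace_scale[OF point_ideal_subspace])
          then show ?thesis by (simp add: mult.commute)
        qed
      qed
      have "0 \<in> point_ideal p" by (rule ideal.subspace_0[OF point_ideal_subspace[OF pP]])
      then have g0: "g p \<noteq> 0" using g(2)[OF p] by metis
      have "a j \<in> cone_ideal v" if "j \<in> J" for j
        using a_I[OF that] p v(3) by (auto simp: vanishing_ideal_def)
      then have "\<exists>u w. a j = u * l + w * l'" if "j \<in> J" for j using gen that by blast
      from quadric_relation_local[OF J l(1,2) reg[rule_format] this g0 gI[OF l(3)] gI[OF l(4)] q]
      show ?thesis .
    qed
    define h where "h = (\<Sum>p\<in>X. (g p)\<^sup>2)"
    have h_notin: "h \<notin> point_ideal p" if p: "p \<in> X" for p
    proof
      assume h: "h \<in> point_ideal p"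
      have pP: "p \<in> proj_plane" using p X(2) by blast
      have "(\<Sum>r\<in>X - {p}. (g r)\<^sup>2) \<in> point_ideal p"
      proof (rule ideal.subspace_sum[OF point_ideal_subspace[OF pP]])
        fix r assume "r \<in> X - {p}"
        then have "g r \<in> point_ideal p" using g(1)[of r] p by (auto simp: vanishing_ideal_def)
        then show "(g r)\<^sup>2 \<in> point_ideal p"
          unfolding power2_eq_square by (rule ideal.subspace_scale[OF point_ideal_subspace[OF pP]])
      qed
      moreover have "(g p)\<^sup>2 = h - (\<Sum>r\<in>X - {p}. (g r)\<^sup>2)"
        unfolding h_def by (subst sum.remove[OF X(1) p]) simp
      ultimately have "g p * g p \<in> point_ideal p"
        using ideal.subspace_diff[OF point_ideal_subspace[OF pP] h] by (simp add: power2_eq_square)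
      then show False using point_ideal_prime[OF pP] g(2)[OF p] by blast
    qed
    show ?thesis
    proof (rule syz_products_torsion_free[OF J B])
      obtain p where p: "p \<in> X" using False by blast
      then have "0 \<in> point_ideal p" using X(2) by (intro ideal.subspace_0 point_ideal_subspace) blast
      then show "h \<noteq> 0" using h_notin[OF p] by metis
      show "t \<in> combinations J a" if "h * t \<in> combinations J a" for t
        unfolding I_eq vanishing_ideal_def
      proof
        fix p assume p: "p \<in> X"
        have "h * t \<in> point_ideal p" using that p unfolding I_eq vanishing_ideal_def by blast
        moreover have "p \<in> proj_plane" using p X(2) by blast
        ultimately show "t \<in> point_ideal p" using point_ideal_prime h_notin[OF p] by blast
      qed
      show "h dvd r" if "\<And>u. u \<in> combinations J a \<Longrightarrow> h dvd u\<^sup>2 * r" for r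
        using vanishing_ideal_grade[OF X \<open>h \<noteq> 0\<close>] that unfolding I_eq by blast
      have "Cst h * q = (\<Sum>p\<in>X. Cst ((g p)\<^sup>2) * q)"
        by (simp add: h_def Cst_sum sum_distrib_right)
      also have "\<dots> \<in> syz_products J a"
        using gq by (intro forms.subspace_sum[OF syz_products_subspace])
      finally show "Cst h * q \<in> syz_products J a" .
    qed
  qed
  show ?thesis
  proof (rule quadric_relations_change_generators[OF J J' f_combs _ main w])
    show "a j \<in> combinations J' f" if "j \<in> J" for j using a_I[OF that] f by simp
  qed
qed

section \<open>Relation type\<close>

lemma mon_degree_SucE:
  assumes "mon_degree k = Suc n"
  obtains i k' where "i \<in> Poly_Mapping.keys k" "k = Poly_Mapping.single i 1 + k'" "mon_degree k' = n"
proof -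
  have "Poly_Mapping.keys k \<noteq> {}" using assms by (auto simp: mon_degree_def)
  then obtain i where i: "i \<in> Poly_Mapping.keys k" by blast
  define k' where "k' = k - Poly_Mapping.single i 1"
  have k: "k = Poly_Mapping.single i 1 + k'"
  proof (rule poly_mapping_eqI)
    fix j
    show "Poly_Mapping.lookup k j = Poly_Mapping.lookup (Poly_Mapping.single i 1 + k') j"
      using i by (auto simp: k'_def lookup_add lookup_minus lookup_single when_def in_keys_iff)
  qed
  moreover have "mon_degree k' = n"
    using assms unfolding k mon_degree_add by simp
  ultimately show ?thesis using i that by blast
qed

lemma mon_degree_eq_0: "mon_degree k = 0 \<longleftrightarrow> k = 0"
  by (auto simp: mon_degree_def in_keys_iff intro: poly_mapping_eqI)

lemma homogeneous_1_eval:
  assumes "homogeneous 1 P" "P \<in> mpolys m"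
  shows "eval a P \<in> combinations {..<m} a"
  unfolding mpoly_eval_def mon_val_def[symmetric]
proof (intro ideal.subspace_sum[OF combinations_subspace] ideal.subspace_scale[OF combinations_subspace])
  fix k assume k: "k \<in> Poly_Mapping.keys P"
  then have "mon_degree k = Suc 0" using assms(1) by (auto simp: homogeneous_def)
  then obtain i k' where i: "i \<in> Poly_Mapping.keys k" "k = Poly_Mapping.single i 1 + k'" "mon_degree k' = 0"
    by (rule mon_degree_SucE)
  then have "mon_val a k = a i" by (simp add: mon_degree_eq_0 mon_val_single)
  moreover have "i < m" using i(1) k assms(2) by (auto simp: mpolys_def)
  ultimately show "mon_val a k \<in> combinations {..<m} a" using combinations_base[of "{..<m}" i a] by simp
qed

lemma homogeneous_2_quadratic:
  fixes P :: "(nat, 'r::comm_ring_1) mpoly"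
  assumes "homogeneous 2 P" "P \<in> mpolys m"
  shows "P \<in> quadratics {..<m}"
proof -
  have "Poly_Mapping.single k (Poly_Mapping.lookup P k) \<in> quadratics {..<m}"
    if k: "k \<in> Poly_Mapping.keys P" for k
  proof -
    have "mon_degree k = Suc (Suc 0)" using assms(1) k by (auto simp: homogeneous_def)
    then obtain i k' where i: "i \<in> Poly_Mapping.keys k" "k = Poly_Mapping.single i 1 + k'"
      and "mon_degree k' = Suc 0"
      by (rule mon_degree_SucE)
    moreover from this obtain j k'' where "j \<in> Poly_Mapping.keys k'" "k' = Poly_Mapping.single j 1 + k''"
      "mon_degree k'' = 0"
      by (elim mon_degree_SucE)
    ultimately have k_eq: "k = Poly_Mapping.single i 1 + Poly_Mapping.single j 1"
      by (simp add: mon_degree_eq_0)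
    then have "j \<in> Poly_Mapping.keys k" by (simp add: in_keys_iff lookup_add)
    then have "i < m" "j < m" using i(1) k assms(2) by (auto simp: mpolys_def)
    then have "Var i * Var j \<in> quadratics {..<m}"
      unfolding quadratics_def by (intro forms.span_base) blast
    moreover have "Poly_Mapping.single k (Poly_Mapping.lookup P k)
        = Cst (Poly_Mapping.lookup P k) * (Var i * Var j)"
      by (simp add: Cst_def Var_def mult_single k_eq)
    ultimately show ?thesis using forms.subspace_scale[OF quadratics_subspace] by metis
  qed
  then have "(\<Sum>k\<in>Poly_Mapping.keys P. Poly_Mapping.single k (Poly_Mapping.lookup P k)) \<in> quadratics {..<m}"
    by (intro forms.subspace_sum[OF quadratics_subspace])
  then show ?thesis by (simp flip: poly_mapping_sum_single)
qed

lemma mpolys_add: "P \<in> mpolys m \<Longrightarrow> Q \<in> mpolys m \<Longrightarrow> P + Q \<in> mpolys m"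
  unfolding mpolys_def using keys_add[of P Q] by blast

lemma mpolys_mult:
  fixes P Q :: "(nat, 'r::comm_ring_1) mpoly"
  assumes "P \<in> mpolys m" "Q \<in> mpolys m" shows "P * Q \<in> mpolys m"
  unfolding mpolys_def
proof safe
  fix t i assume "t \<in> Poly_Mapping.keys (P * Q)" "i \<in> Poly_Mapping.keys t"
  then obtain s u where "s \<in> Poly_Mapping.keys P" "u \<in> Poly_Mapping.keys Q" "t = s + u"
    using keys_mult[of P Q] by blast
  then show "i < m"
    using \<open>i \<in> _\<close> keys_add[of s u] assms by (auto simp: mpolys_def)
qed

lemma mpolys_Cst: "Cst c \<in> mpolys m"
  by (auto simp: mpolys_def Cst_def)

lemma mpolys_sum:
  fixes f :: "'a \<Rightarrow> (nat, 'r::comm_ring_1) mpoly"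
  shows "(\<And>x. x \<in> A \<Longrightarrow> f x \<in> mpolys m) \<Longrightarrow> (\<Sum>x\<in>A. f x) \<in> mpolys m"
proof (induction A rule: infinite_finite_induct)
  case (insert x A)
  then show ?case by (simp add: mpolys_add)
qed (use mpolys_Cst[of "0::'r" m] in simp_all)

lemma lform_in_mpolys: "lform {..<m} g \<in> mpolys m"
  unfolding lform_def
  by (intro mpolys_sum mpolys_mult mpolys_Cst) (auto simp: mpolys_def)

lemma homogeneous_lform: "homogeneous 1 (lform J g)"
  unfolding lform_def
proof (induction J rule: infinite_finite_induct)
  case (insert j J)
  have "homogeneous 1 (Cst (g j) * Var j)"
    using keys_mult[of "Cst (g j)" "Var j"] by (auto simp: homogeneous_def Cst_def split: if_splits)
  then show ?case
    using insert keys_add[of "Cst (g j) * Var j" "\<Sum>j\<in>J. Cst (g j) * Var j"]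
    by (auto simp: homogeneous_def)
qed (simp_all add: homogeneous_def)

lemma mpoly_eval_cong:
  assumes "P \<in> mpolys m" "\<And>i. i < m \<Longrightarrow> f i = g i"
  shows "mpoly_eval \<phi> f P = mpoly_eval \<phi> g P"
  unfolding mpoly_eval_def
proof (intro sum.cong refl arg_cong2[where f = "(*)"] prod.cong)
  fix k i assume "k \<in> Poly_Mapping.keys P" "i \<in> Poly_Mapping.keys k"
  then have "i < m" using assms(1) by (auto simp: mpolys_def)
  then show "f i ^ Poly_Mapping.lookup k i = g i ^ Poly_Mapping.lookup k i" by (simp add: assms(2))
qed

lemma ideal_gen_in_0: "0 \<in> ideal_gen_in S B"
  unfolding ideal_gen_in_def by (intro CollectI exI[of _ "{}"]) auto

lemma ideal_gen_in_base: "1 \<in> S \<Longrightarrow> b \<in> B \<Longrightarrow> b \<in> ideal_gen_in S B"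
  unfolding ideal_gen_in_def by (intro CollectI exI[of _ "{b}"] exI[of _ "\<lambda>_. 1"]) auto

lemma ideal_gen_in_add:
  assumes S: "0 \<in> S" "\<And>x y. x \<in> S \<Longrightarrow> y \<in> S \<Longrightarrow> x + y \<in> S"
    and "u \<in> ideal_gen_in S B" "v \<in> ideal_gen_in S B"
  shows "u + v \<in> ideal_gen_in S B"
proof -
  obtain F c where F: "finite F" "F \<subseteq> B" "\<forall>b\<in>F. c b \<in> S" "u = (\<Sum>b\<in>F. c b * b)"
    using assms(3) unfolding ideal_gen_in_def by blast
  obtain G d where G: "finite G" "G \<subseteq> B" "\<forall>b\<in>G. d b \<in> S" "v = (\<Sum>b\<in>G. d b * b)"
    using assms(4) unfolding ideal_gen_in_def by blast
  let ?c = "\<lambda>b. if b \<in> F then c b else 0" and ?d = "\<lambda>b. if b \<in> G then d b else 0"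
  have "u = (\<Sum>b\<in>F \<union> G. ?c b * b)"
    unfolding F(4) using F(1) G(1) by (intro sum.mono_neutral_cong_left) auto
  moreover have "v = (\<Sum>b\<in>F \<union> G. ?d b * b)"
    unfolding G(4) using F(1) G(1) by (intro sum.mono_neutral_cong_left) auto
  ultimately have "u + v = (\<Sum>b\<in>F \<union> G. (?c b + ?d b) * b)"
    by (simp add: distrib_right sum.distrib)
  moreover have "?c b + ?d b \<in> S" for b using F(3) G(3) S by auto
  ultimately show ?thesis
    unfolding ideal_gen_in_def using F(1,2) G(1,2)
    by (intro CollectI exI[of _ "F \<union> G"] exI[of _ "\<lambda>b. ?c b + ?d b"]) auto
qed

lemma ideal_gen_in_mult:
  assumes S: "\<And>x y. x \<in> S \<Longrightarrow> y \<in> S \<Longrightarrow> x * y \<in> S" and "s \<in> S" "u \<in> ideal_gen_in S B"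
  shows "s * u \<in> ideal_gen_in S B"
proof -
  obtain F c where F: "finite F" "F \<subseteq> B" "\<forall>b\<in>F. c b \<in> S" "u = (\<Sum>b\<in>F. c b * b)"
    using assms(3) unfolding ideal_gen_in_def by blast
  have "s * u = (\<Sum>b\<in>F. (s * c b) * b)" unfolding F(4) by (simp add: sum_distrib_left mult.assoc)
  then show ?thesis
    unfolding ideal_gen_in_def using F S assms(2)
    by (intro CollectI exI[of _ F] exI[of _ "\<lambda>b. s * c b"]) auto
qed

lemma mpolys_ideal_gen_in_closed:
  fixes B :: "(nat, 'r::comm_ring_1) mpoly set"
  shows "u \<in> ideal_gen_in (mpolys m) B \<Longrightarrow> v \<in> ideal_gen_in (mpolys m) B \<Longrightarrow> u + v \<in> ideal_gen_in (mpolys m) B"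
    and "s \<in> mpolys m \<Longrightarrow> u \<in> ideal_gen_in (mpolys m) B \<Longrightarrow> s * u \<in> ideal_gen_in (mpolys m) B"
    and "b \<in> B \<Longrightarrow> b \<in> ideal_gen_in (mpolys m) B"
proof -
  have 0: "(0 :: (nat, 'r) mpoly) \<in> mpolys m" "(1 :: (nat, 'r) mpoly) \<in> mpolys m" using mpolys_Cst[of "0::'r" m] mpolys_Cst[of "1::'r" m] by simp_all
  show "u \<in> ideal_gen_in (mpolys m) B \<Longrightarrow> v \<in> ideal_gen_in (mpolys m) B \<Longrightarrow> u + v \<in> ideal_gen_in (mpolys m) B"
    using 0 mpolys_add by (intro ideal_gen_in_add) auto
  show "s \<in> mpolys m \<Longrightarrow> u \<in> ideal_gen_in (mpolys m) B \<Longrightarrow> s * u \<in> ideal_gen_in (mpolys m) B"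
    using mpolys_mult by (intro ideal_gen_in_mult) auto
  show "b \<in> B \<Longrightarrow> b \<in> ideal_gen_in (mpolys m) B"
    using 0 by (intro ideal_gen_in_base)
qed

lemma ideal_gen_in_least:
  assumes "B \<subseteq> T" "0 \<in> T" "\<And>x y. x \<in> T \<Longrightarrow> y \<in> T \<Longrightarrow> x + y \<in> T" "\<And>s x. s \<in> S \<Longrightarrow> x \<in> T \<Longrightarrow> s * x \<in> T"
  shows "ideal_gen_in S B \<subseteq> T"
proof
  fix u assume "u \<in> ideal_gen_in S B"
  then obtain F c where F: "finite F" "F \<subseteq> B" "\<forall>b\<in>F. c b \<in> S" "u = (\<Sum>b\<in>F. c b * b)"
    unfolding ideal_gen_in_def by blast
  have "(\<Sum>b\<in>F. c b * b) \<in> T"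
    using F(1-3) assms by (induction F rule: finite_induct) auto
  then show "u \<in> T" by (simp add: F(4))
qed

lemma ideal_power_1:
  assumes "ideal.subspace I" shows "ideal_power I 1 = I"
proof -
  have "{\<Prod>j<1. a j | a. \<forall>j<1::nat. a j \<in> I} = I"
  proof safe
    fix x assume "x \<in> I"
    then show "\<exists>a. x = (\<Prod>j<1. a j) \<and> (\<forall>j<1::nat. a j \<in> I)" by (intro exI[of _ "\<lambda>_. x"]) simp
  qed auto
  then show ?thesis unfolding ideal_power_def using assms by (simp add: ideal.span_eq_iff)
qed

text \<open>
  Generators of degree one of the Rees algebra are the same as generators of the ideal: the degree one
  part of a polynomial expression in them is a linear combination.
\<close>

lemma rees_degree_one_generators:
  fixes I :: "'r::comm_ring_1 set"
  assumes I: "ideal.subspace I" and gen: "degree_one_generators (\<lambda>r. [:r:]) (rees_piece I) m f"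
  obtains a where "\<forall>i<m. f i = monom (a i) 1" "combinations {..<m} a = I"
proof
  define a where "a i = coeff (f i) 1" for i
  have piece: "rees_piece I 1 = {monom b 1 | b. b \<in> I}"
    unfolding rees_piece_def ideal_power_1[OF I] ..
  have f: "\<exists>b\<in>I. f i = monom b 1" if "i < m" for i
    using gen that unfolding degree_one_generators_def piece by blast
  have f_eq: "f i = monom (a i) 1" if "i < m" for i
    using f[OF that] by (auto simp: a_def)
  then show "\<forall>i<m. f i = monom (a i) 1" by blast
  have a_I: "a i \<in> I" if "i < m" for i
    using f[OF that] by (auto simp: a_def)
  show "combinations {..<m} a = I"
  proof
    show "combinations {..<m} a \<subseteq> I"
      unfolding combinations_def dot_def using a_I
      by (auto intro!: ideal.subspace_sum[OF I] ideal.subspace_scale[OF I])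
    show "I \<subseteq> combinations {..<m} a"
    proof
      fix u assume u: "u \<in> I"
      interpret graded_algebra "\<lambda>r. [:r:]" "rees_piece I" by (rule graded_algebra_rees)
      have "monom u 1 = (\<Sum>n\<le>1::nat. if n = 1 then monom u 1 else 0)"
        by (subst sum.delta) simp_all
      moreover have "(if n = 1 then monom u 1 else 0) \<in> rees_piece I n" for n
      proof (cases "n = 1")
        case True
        show ?thesis unfolding True piece using u by auto
      qed (simp add: zero_mem)
      ultimately have "monom u 1 \<in> total (rees_piece I)"
        unfolding total_def by (intro CollectI exI[of _ 1] exI[of _ "\<lambda>n. if n = 1 then monom u 1 else 0"]) blast
      then obtain P where P: "P \<in> mpolys m" "monom u 1 = mpoly_eval (\<lambda>r. [:r:]) f P"
        using gen unfolding degree_one_generators_def by (metis imageE)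
      have "monom u 1 = mpoly_eval (\<lambda>r. [:r:]) (\<lambda>i. monom (a i) 1) P"
        unfolding P(2) by (rule mpoly_eval_cong[OF P(1) f_eq])
      from arg_cong[OF this, of "\<lambda>p. coeff p 1"] have "u = eval a (hcomp 1 P)"
        unfolding coeff_eval_cone by simp
      moreover have "hcomp 1 P \<in> mpolys m" using P(1) by (auto simp: mpolys_def keys_restr)
      ultimately show "u \<in> combinations {..<m} a"
        using homogeneous_1_eval[OF homogeneous_hcomp] by simp
    qed
  qed
qed

text \<open>
  A homogeneous relation of the Rees algebra is a relation between the generators of the ideal, so one
  of degree two lies in the ideal generated by the linear relations when the ideal is syzygetic.
\<close>

lemma relations_generated_up_to_2_imp_1:
  fixes I :: "'r::comm_ring_1 set"
  assumes I: "ideal.subspace I" and gen: "degree_one_generators (\<lambda>r. [:r:]) (rees_piece I) m f"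
    and syzygetic: "\<And>a w. combinations {..<m} a = I \<Longrightarrow> w \<in> quadratics {..<m} \<Longrightarrow> eval a w = 0 \<Longrightarrow>
      w \<in> syz_products {..<m} a"
    and 2: "relations_generated_up_to (\<lambda>r. [:r:]) m f 2"
  shows "relations_generated_up_to (\<lambda>r. [:r:]) m f 1"
proof -
  let ?\<phi> = "\<lambda>r :: 'r. [:r:]"
  obtain a where a: "\<forall>i<m. f i = monom (a i) 1" "combinations {..<m} a = I"
    using rees_degree_one_generators[OF I gen] .
  let ?Rel = "relations ?\<phi> m f"
  let ?gens = "\<lambda>l. {P \<in> ?Rel. \<exists>d\<le>l. homogeneous d P}"
  let ?T = "ideal_gen_in (mpolys m) (?gens 1)"
  note T = mpolys_ideal_gen_in_closed[where B = "?gens 1" and m = m]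
  have eval_f: "mpoly_eval ?\<phi> f P = mpoly_eval ?\<phi> (\<lambda>i. monom (a i) 1) P" if "P \<in> mpolys m" for P
    by (rule mpoly_eval_cong[OF that]) (use a(1) in blast)
  have eval_0: "eval a P = 0" if "P \<in> ?Rel" "homogeneous d P" for P d
  proof -
    have "P \<in> mpolys m" "mpoly_eval ?\<phi> f P = 0" using that(1) by (auto simp: relations_def)
    then have "mpoly_eval ?\<phi> (\<lambda>i. monom (a i) 1) P = 0" using eval_f by metis
    from arg_cong[OF this, of "\<lambda>p. coeff p d"] show ?thesis
      unfolding coeff_eval_cone hcomp_homogeneous[OF that(2)] by simp
  qed
  have syz_in: "lform {..<m} s \<in> ?T" if s: "s \<in> syz {..<m} a" for s
  proof (rule T(3), safe)
    have "mpoly_eval ?\<phi> (\<lambda>i. monom (a i) 1) (lform {..<m} s) = 0"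
    proof (rule poly_eqI)
      fix d
      show "coeff (mpoly_eval ?\<phi> (\<lambda>i. monom (a i) 1) (lform {..<m} s)) d = coeff 0 d"
        unfolding coeff_eval_cone hcomp_homogeneous[OF homogeneous_lform]
        using s by (auto simp: eval_lform eval.eval_0 syz_def)
    qed
    then have "mpoly_eval ?\<phi> f (lform {..<m} s) = 0"
      unfolding eval_f[OF lform_in_mpolys] .
    then show "lform {..<m} s \<in> ?Rel" by (simp add: relations_def lform_in_mpolys)
    show "\<exists>d\<le>1. homogeneous d (lform {..<m} s)" using homogeneous_lform by blast
  qed
  have low: "P \<in> ?T" if P: "P \<in> ?Rel" and d: "d \<le> 2" "homogeneous d P" for P d
  proof -
    show ?thesis
    proof (cases "d = 2")
      case True
      then have "P \<in> syz_products {..<m} a"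
        using d P by (intro syzygetic a(2) homogeneous_2_quadratic eval_0) (auto simp: relations_def)
      then show ?thesis
        unfolding syz_products_def
      proof (induction rule: forms.span_induct_alt)
        case base
        show ?case by (rule ideal_gen_in_0)
      next
        case (step c x y)
        then obtain g s where x: "x = lform {..<m} g * lform {..<m} s" and s: "s \<in> syz {..<m} a"
          by blast
        have "Cst c * x \<in> ?T"
          unfolding x by (intro T(2) mpolys_Cst lform_in_mpolys syz_in s)
        then show ?case using step.IH by (rule T(1))
      qed
    next
      case False
      then have "d \<le> 1" using d by simp
      then show ?thesis using d(2) P by (intro T(3) CollectI conjI exI[of _ d])
    qed
  qed
  have "ideal_gen_in (mpolys m) (?gens 2) \<subseteq> ?T"
  proof (rule ideal_gen_in_least)
    show "?gens 2 \<subseteq> ?T" using low by (intro subsetI) (elim CollectE conjE exE)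
  qed (rule ideal_gen_in_0 T(1,2); assumption)+
  then have "?Rel \<subseteq> ?T"
    by (simp only: 2[unfolded relations_generated_up_to_def, symmetric])
  moreover have "?T \<subseteq> ?Rel"
  proof (rule ideal_gen_in_least)
    show "0 \<in> ?Rel" by (simp add: relations_def mpolys_def rees.eval_0)
    show "x + y \<in> ?Rel" if "x \<in> ?Rel" "y \<in> ?Rel" for x y
      using that mpolys_add by (auto simp: relations_def rees.eval_add)
    show "s * x \<in> ?Rel" if "s \<in> mpolys m" "x \<in> ?Rel" for s x
      using that mpolys_mult by (auto simp: relations_def rees.eval_mult)
  qed auto
  ultimately show ?thesis unfolding relations_generated_up_to_def by blast
qed

theorem proposition3p6:
  fixes X :: "('k::field ^ 3) set set" and s :: nat
  assumes "X \<subseteq> proj_plane" and "finite X" and "card X = s"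
  shows "rt X = 1 \<or> rt X \<ge> 3"
proof (cases "rt X \<ge> 3")
  case False
  let ?I = "vanishing_ideal X" and ?\<phi> = "\<lambda>r :: (3, 'k) mpoly. [:r:]"
  let ?L = "{enat l | l m f. 1 \<le> l \<and> degree_one_generators ?\<phi> (rees_piece ?I) m f \<and>
    relations_generated_up_to ?\<phi> m f l}"
  have rt: "rt X = Inf ?L"
    unfolding rt_def relation_type_ideal_def relation_type_def ..
  have "Inf ?L < 3" using False unfolding rt by simp
  then obtain l m f where l: "enat l < 3" "1 \<le> l" and gen: "degree_one_generators ?\<phi> (rees_piece ?I) m f"
    and rel: "relations_generated_up_to ?\<phi> m f l"
    unfolding Inf_less_iff by blast
  have "l < 3" using l(1) by (simp add: numeral_eq_enat)
  with l(2) consider "l = 1" | "l = 2" by linarith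
  then have "relations_generated_up_to ?\<phi> m f 1"
  proof cases
    case 1
    then show ?thesis using rel by simp
  next
    case 2
    show ?thesis
      using relations_generated_up_to_2_imp_1[OF vanishing_ideal_subspace[OF assms(1)] gen
          vanishing_ideal_syzygetic[OF assms(2,1) finite_lessThan]] rel
      unfolding 2 by blast
  qed
  then have "enat 1 \<in> ?L" using gen by blast
  then have "Inf ?L \<le> enat 1" by (rule Inf_lower)
  moreover have "enat 1 \<le> Inf ?L" by (rule Inf_greatest) auto
  ultimately show ?thesis unfolding rt by (simp add: one_enat_def)
qed simp

end
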